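(* Let $1<p<\infty$, let $a_j\in GL^\infty$, $j=1,2,3,4$, and let $A:H^p\to H^p$ be one of the four operators $$T(a_1)-H(a_1t^{-1}),\quad T(a_2)+H(a_2t),\quad T(a_3)+H(a_3),\quad T(a_4)-H(a_4).$$ If $A$ is generalized invertible, then $A$ is one-sided invertible.
   Context: $\mathbb{T}$ is the unit circle, $L^p=L^p(\mathbb{T})$, $H^p=\{f\in L^p:\widehat f_n=0 \text{ for } n<0\}$, $P$ is the Riesz projection of $L^p$ onto $H^p$, $Q=I-P$, and $(Jf)(t)=\overline{t}f(\overline{t})$. $GL^\infty$ is the group of invertible elements of $L^\infty=L^\infty(\mathbb T)$. For $a\in L^\infty$, on $H^p$: $T(a)f=P(af)$ (Toeplitz operator), $H(a)f=PaQJf$ (Hankel operator). $t$ denotes the identity function on $\mathbb{T}$. A bounded operator $A$ is generalized invertible if there is a bounded operator $B$ with $ABA=A$. *)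

theory Defs
  imports "HOL-Analysis.Analysis"
begin

text \<open>
  The normalized arc length measure on the unit circle.  An element of \<open>L\<^sup>p\<close> is
  represented by a function \<open>complex \<Rightarrow> complex\<close> whose values off the circle are irrelevant;
  functions and operators are compared almost everywhere with respect to this measure.
\<close>

definition circle :: "complex measure" where
  "circle = distr (uniform_measure lborel {0..<2 * pi}) (restrict_space borel (sphere 0 1)) cis"

definition Lp :: "real \<Rightarrow> (complex \<Rightarrow> complex) set" where
  "Lp p = {f \<in> borel_measurable circle. integrable circle (\<lambda>t. norm (f t) powr p)}"

definition Lp_norm :: "real \<Rightarrow> (complex \<Rightarrow> complex) \<Rightarrow> real" where
  "Lp_norm p f = (LINT t|circle. norm (f t) powr p) powr (1 / p)"

definition Linf :: "(complex \<Rightarrow> complex) set" where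
  "Linf = {a \<in> borel_measurable circle. \<exists>C. AE t in circle. norm (a t) \<le> C}"

definition GLinf :: "(complex \<Rightarrow> complex) set" where
  "GLinf = {a \<in> Linf. \<exists>b\<in>Linf. AE t in circle. a t * b t = 1}"

definition fourier_coeff :: "(complex \<Rightarrow> complex) \<Rightarrow> int \<Rightarrow> complex" where
  "fourier_coeff f n = (LINT t|circle. f t * t powi (- n))"

definition Hp :: "real \<Rightarrow> (complex \<Rightarrow> complex) set" where
  "Hp p = {f \<in> Lp p. \<forall>n<0. fourier_coeff f n = 0}"

text \<open>
  The Riesz projection sends \<open>\<Sum>n. c\<^sub>n t\<^sup>n\<close> to \<open>\<Sum>n\<ge>0. c\<^sub>n t\<^sup>n\<close>.
  For \<open>1 < p\<close> and \<open>f \<in> Lp p\<close> the function chosen here exists by the theorem of M. Riesz,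
  and it is unique up to a null set because Fourier coefficients determine a function
  almost everywhere.
\<close>

definition riesz_P :: "real \<Rightarrow> (complex \<Rightarrow> complex) \<Rightarrow> complex \<Rightarrow> complex" where
  "riesz_P p f = (SOME g. g \<in> Lp p \<and>
     (\<forall>n. fourier_coeff g n = (if n \<ge> 0 then fourier_coeff f n else 0)))"

definition riesz_Q :: "real \<Rightarrow> (complex \<Rightarrow> complex) \<Rightarrow> complex \<Rightarrow> complex" where
  "riesz_Q p f = (\<lambda>t. f t - riesz_P p f t)"

definition flip_J :: "(complex \<Rightarrow> complex) \<Rightarrow> complex \<Rightarrow> complex" where
  "flip_J f = (\<lambda>t. cnj t * f (cnj t))"

definition toeplitz ::
  "real \<Rightarrow> (complex \<Rightarrow> complex) \<Rightarrow> (complex \<Rightarrow> complex) \<Rightarrow> complex \<Rightarrow> complex" where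
  "toeplitz p a f = riesz_P p (\<lambda>t. a t * f t)"

definition hankel ::
  "real \<Rightarrow> (complex \<Rightarrow> complex) \<Rightarrow> (complex \<Rightarrow> complex) \<Rightarrow> complex \<Rightarrow> complex" where
  "hankel p a f = riesz_P p (\<lambda>t. a t * riesz_Q p (flip_J f) t)"

text \<open>
  Bounded linear operators on \<open>H\<^sup>p\<close>.  Linearity and the norm bound together force such a
  map to send almost everywhere equal functions to almost everywhere equal functions, so it
  induces an operator on the space of equivalence classes.
\<close>

definition bounded_op_Hp ::
  "real \<Rightarrow> ((complex \<Rightarrow> complex) \<Rightarrow> complex \<Rightarrow> complex) \<Rightarrow> bool" where
  "bounded_op_Hp p B \<longleftrightarrow>
     (\<forall>f\<in>Hp p. B f \<in> Hp p) \<and>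
     (\<forall>f\<in>Hp p. \<forall>g\<in>Hp p. AE t in circle. B (\<lambda>s. f s + g s) t = B f t + B g t) \<and>
     (\<forall>c. \<forall>f\<in>Hp p. AE t in circle. B (\<lambda>s. c * f s) t = c * B f t) \<and>
     (\<exists>C. \<forall>f\<in>Hp p. Lp_norm p (B f) \<le> C * Lp_norm p f)"

definition op_eq_Hp ::
  "real \<Rightarrow> ((complex \<Rightarrow> complex) \<Rightarrow> complex \<Rightarrow> complex) \<Rightarrow>
    ((complex \<Rightarrow> complex) \<Rightarrow> complex \<Rightarrow> complex) \<Rightarrow> bool" where
  "op_eq_Hp p A B \<longleftrightarrow> (\<forall>f\<in>Hp p. AE t in circle. A f t = B f t)"

text \<open>
  The following notions are meant for an \<open>A\<close> that represents a bounded operator on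
  \<open>H\<^sup>p\<close>, as the Toeplitz plus Hankel operators do for \<open>1 < p\<close>; only the
  operator \<open>B\<close> is required to be bounded explicitly.
\<close>

definition generalized_invertible_Hp ::
  "real \<Rightarrow> ((complex \<Rightarrow> complex) \<Rightarrow> complex \<Rightarrow> complex) \<Rightarrow> bool" where
  "generalized_invertible_Hp p A \<longleftrightarrow> (\<exists>B. bounded_op_Hp p B \<and> op_eq_Hp p (A \<circ> B \<circ> A) A)"

definition left_invertible_Hp ::
  "real \<Rightarrow> ((complex \<Rightarrow> complex) \<Rightarrow> complex \<Rightarrow> complex) \<Rightarrow> bool" where
  "left_invertible_Hp p A \<longleftrightarrow> (\<exists>B. bounded_op_Hp p B \<and> op_eq_Hp p (B \<circ> A) id)"

definition right_invertible_Hp ::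
  "real \<Rightarrow> ((complex \<Rightarrow> complex) \<Rightarrow> complex \<Rightarrow> complex) \<Rightarrow> bool" where
  "right_invertible_Hp p A \<longleftrightarrow> (\<exists>B. bounded_op_Hp p B \<and> op_eq_Hp p (A \<circ> B) id)"

definition one_sided_invertible_Hp ::
  "real \<Rightarrow> ((complex \<Rightarrow> complex) \<Rightarrow> complex \<Rightarrow> complex) \<Rightarrow> bool" where
  "one_sided_invertible_Hp p A \<longleftrightarrow> left_invertible_Hp p A \<or> right_invertible_Hp p A"

end

theory Submission
  imports Defs "HOL-Complex_Analysis.Conformal_Mappings"
begin

text \<open>
  On \<open>H\<^sup>p\<close> each of the four operators is \<open>A f = P (a S f)\<close> with
  \<open>(S f)(t) = f(t) + \<sigma> t\<^sup>m f(1/t)\<close> and \<open>\<sigma> = \<plusminus>1\<close>.  Suppose \<open>A f = 0\<close> with \<open>f \<noteq> 0\<close>.  Then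
  \<open>h = a S f \<noteq> 0\<close> has only negative frequencies.  For even \<open>s = t\<^sup>N + t\<^sup>-\<^sup>N\<close> the product
  \<open>s S f\<close> is again some \<open>S g\<close> with \<open>g \<in> H\<^sup>p\<close>, and \<open>A g = P (s h)\<close> is a polynomial whose degree
  is exactly \<open>N\<close> minus a constant.  Hence a nontrivial kernel forces the range of \<open>A\<close> to contain
  all polynomials.  If \<open>A B A = A\<close>, then \<open>A B\<close> is the identity on the range of \<open>A\<close>, so in this
  case \<open>A B = I\<close> by density; if the kernel is trivial, \<open>B A = I\<close>.

  That \<open>P\<close> is defined on \<open>L\<^sup>p\<close> is the theorem of M. Riesz.  For \<open>1 < p \<le> 2\<close> it comes from
  \<open>|z|\<^sup>p \<le> A (Re z)\<^sup>p - B Re z\<^sup>p\<close> on the right half plane and the mean value property of \<open>q\<^sup>p\<close> for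
  polynomials \<open>q\<close> with positive real part; Cotlar's trick passes from \<open>p\<close> to \<open>2 p\<close>.
\<close>

section \<open>The circle as a probability space\<close>

text \<open>The delicate point is the factor \<open>t^N + t^-N\<close>: while \<open>t^N f\<close>
  stays in \<open>H^p\<close>, the product \<open>t^-N f\<close> acquires negative powers, which
  must be traded for nonnegative ones without changing \<open>S\<close>. On the circle
  \<open>S\<close> cannot distinguish \<open>t^j\<close> from \<open>\<sigma> t^(m-j)\<close>; this
  repairs every power unless \<open>j\<close> and \<open>m - j\<close> are both negative. Only
  \<open>m = -2\<close> has such a power, \<open>t^-1\<close>, and \<open>\<sigma> = -1\<close>
  makes \<open>S\<close> annihilate it. For \<open>m = 0\<close>, on the other hand,
  \<open>\<sigma> = 1\<close> keeps \<open>S\<close> from annihilating the constants. So the shifts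
  \<open>m = 0\<close> and \<open>m = -2\<close> come with one sign each, while
  \<open>m = -1\<close> admits both. Operators are compared only almost everywhere and the
  projection is a chosen function, so the argument runs on the Fourier coefficients with index
  \<open>n \<ge> 0\<close>. In the Riesz inequality the obstacle is positivity: \<open>q^p\<close>
  needs a positive real part, but positive and negative parts of a trigonometric polynomial are not
  trigonometric polynomials. They are approximated uniformly, and the resulting discrepancy is
  controlled by orthogonality in \<open>L^2\<close>, which suffices for
  \<open>p \<le> 2\<close>.\<close>

lemma sets_circle [measurable_cong]: "sets circle = sets (restrict_space borel (sphere 0 1))"
  by (simp add: circle_def)

lemma space_circle [simp]: "space circle = sphere 0 1"
  by (simp add: circle_def space_restrict_space)

lemma cis_measurable [measurable]: "cis \<in> borel \<rightarrow>\<^sub>M restrict_space borel (sphere 0 1)"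
  by (rule measurable_restrict_space2) 
     (auto intro!: borel_measurable_continuous_onI continuous_intros)

lemma emeasure_circle: "emeasure circle (space circle) = 1"
proof -
  have [measurable]: "cis \<in> uniform_measure lborel {0..<2 * pi} \<rightarrow>\<^sub>M restrict_space borel (sphere 0 1)"
    by measurable
  have "cis -` sphere 0 1 \<inter> UNIV = UNIV" by auto
  then show ?thesis
    unfolding circle_def
    by (subst emeasure_distr)
       (use sets.top[of "restrict_space borel (sphere 0 (1::real) :: complex set)"] in
         \<open>auto simp: space_restrict_space ennreal_divide_self\<close>)
qed

interpretation circle: finite_measure circle
  by (rule finite_measureI) (simp only: emeasure_circle, simp)

lemma measure_circle [simp]: "measure circle (sphere 0 1) = 1"
  using emeasure_circle by (simp add: measure_def)

text \<open>The parameter interval [0,1) is the one of \<open>circlepath 0 1\<close>, so that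
  contour integrals can be compared with integrals over \<open>circle\<close>.\<close>

lemma integral_circle:
  fixes f :: "complex \<Rightarrow> 'b::{banach, second_countable_topology}"
  assumes f [measurable]: "f \<in> borel_measurable circle"
  shows "(LINT t|circle. f t) = (LINT x|lborel. indicat_real {0..<1} x *\<^sub>R f (cis (2 * pi * x)))"
proof -
  have f' [measurable]: "f \<in> borel_measurable (restrict_space borel (sphere 0 1))"
    using f by (simp add: measurable_cong_sets[OF sets_circle refl])
  have "(LINT t|circle. f t) = (LINT x|uniform_measure lborel {0..<2 * pi}. f (cis x))"
    unfolding circle_def by (rule integral_distr) measurable
  also have "uniform_measure lborel {0..<2 * pi}
      = density lborel (\<lambda>x. ennreal (indicator {0..<2*pi} x / (2 * pi)))"
    unfolding uniform_measure_def
    by (intro density_cong AE_I2)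
       (auto split: split_indicator simp: divide_ennreal ennreal_1[symmetric] simp del: ennreal_1)
  also have "(LINT x|density lborel (\<lambda>x. ennreal (indicator {0..<2*pi} x / (2 * pi))). f (cis x))
      = (LINT x|lborel. (indicator {0..<2*pi} x / (2 * pi)) *\<^sub>R f (cis x))"
    by (rule integral_density) auto
  also have "\<dots> = (2 * pi) *\<^sub>R (LINT x|lborel. (indicator {0..<2*pi} (0 + (2*pi) * x) / (2 * pi)) *\<^sub>R f (cis (0 + (2*pi) * x)))"
    by (subst lborel_integral_real_affine[of "2 * pi" _ 0]) auto
  also have "\<dots> = (LINT x|lborel. (2*pi) *\<^sub>R ((indicator {0..<2*pi} (0 + (2*pi) * x) / (2 * pi)) *\<^sub>R f (cis (0 + (2*pi) * x))))"
    by (rule integral_scaleR_right[symmetric])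
  also have "\<dots> = (LINT x|lborel. indicat_real {0..<1} x *\<^sub>R f (cis (2 * pi * x)))"
    by (intro Bochner_Integration.integral_cong) (auto split: split_indicator simp: zero_le_mult_iff not_le[THEN iffD2, OF pi_gt_zero])
  finally show ?thesis .
qed

lemma borel_measurable_circleI:
  "f \<in> borel_measurable borel \<Longrightarrow> f \<in> borel_measurable circle"
  by (simp add: measurable_cong_sets[OF sets_circle refl] measurable_restrict_space1)

lemma borel_measurable_circle_continuous:
  fixes f :: "complex \<Rightarrow> 'b::{banach, second_countable_topology}"
  shows "continuous_on (sphere 0 1) f \<Longrightarrow> f \<in> borel_measurable circle"
  by (simp add: measurable_cong_sets[OF sets_circle refl] borel_measurable_continuous_on_restrict)

lemma measurable_cnj_circle [measurable]: "cnj \<in> circle \<rightarrow>\<^sub>M circle"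
  unfolding measurable_cong_sets[OF sets_circle sets_circle]
  by (intro measurable_restrict_space3)
     (auto intro!: borel_measurable_continuous_onI continuous_intros)

text \<open>Conjugation is the reflection \<open>x \<mapsto> 1 - x\<close> of the parameter
  interval. It moves the closed end from 0 to 1, which changes the integrand only at two
  points.\<close>

lemma integral_circle_cnj:
  fixes f :: "complex \<Rightarrow> 'b::{banach, second_countable_topology}"
  assumes f [measurable]: "f \<in> borel_measurable circle"
  shows "(LINT t|circle. f (cnj t)) = (LINT t|circle. f t)"
proof -
  have [measurable]: "f \<in> borel_measurable (restrict_space borel (sphere 0 1))"
    using f by (simp add: measurable_cong_sets[OF sets_circle refl])
  have [measurable]: "(\<lambda>x. f (cis (2 * pi * x))) \<in> borel_measurable borel" by measurable
  have cis1: "cis (2 * pi * (1 - x)) = cnj (cis (2 * pi * x))" for x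
    by (simp add: cis_cnj right_diff_distrib flip: cis_divide) (simp add: divide_inverse)
  have "(LINT t|circle. f t) = (LINT x|lborel. indicat_real {0..<1} x *\<^sub>R f (cis (2 * pi * x)))"
    by (rule integral_circle) fact
  also have "\<dots> = (LINT x|lborel. indicat_real {0..<1} (1 - x) *\<^sub>R f (cnj (cis (2 * pi * x))))"
    by (subst lborel_integral_real_affine[of "-1" _ 1]) (auto simp: cis1)
  also have "\<dots> = (LINT x|lborel. indicat_real {0..<1} x *\<^sub>R f (cnj (cis (2 * pi * x))))"
  proof (rule integral_cong_AE)
    have m: "(\<lambda>x. f (cnj (cis (2 * pi * x)))) \<in> borel_measurable borel"
      unfolding cis1[symmetric] by measurable
    show "(\<lambda>x. indicat_real {0..<1} (1 - x) *\<^sub>R f (cnj (cis (2 * pi * x)))) \<in> borel_measurable lborel"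
      "(\<lambda>x. indicat_real {0..<1} x *\<^sub>R f (cnj (cis (2 * pi * x)))) \<in> borel_measurable lborel"
      using m by measurable
    have "AE x in lborel. x \<noteq> (0::real)" "AE x in lborel. x \<noteq> (1::real)"
      by (rule AE_lborel_singleton)+
    then show "AE x in lborel. indicat_real {0..<1} (1 - x) *\<^sub>R f (cnj (cis (2 * pi * x)))
        = indicat_real {0..<1} x *\<^sub>R f (cnj (cis (2 * pi * x)))"
      by eventually_elim (auto split: split_indicator)
  qed
  also have "\<dots> = (LINT t|circle. f (cnj t))"
    by (rule integral_circle[symmetric]) measurable
  finally show ?thesis by simp
qed

text \<open>A null set stays null after reflection because the integral of its indicator is
  unchanged. This is needed because \<open>flip_J\<close> evaluates its argument at
  \<open>cnj t\<close>.\<close>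

lemma AE_circle_cnj:
  assumes "AE t in circle. P t"
  shows "AE t in circle. P (cnj t)"
proof -
  obtain N where N: "{t \<in> space circle. \<not> P t} \<subseteq> N" "N \<in> null_sets circle"
    using assms by (auto simp: eventually_ae_filter)
  then have [measurable]: "N \<in> sets circle" by auto
  have "(LINT t|circle. indicat_real N (cnj t)) = (LINT t|circle. indicat_real N t)"
    by (rule integral_circle_cnj) measurable
  also have "\<dots> = 0"
    using N sets.sets_into_space[of N circle] by (simp add: measure_def null_sets_def Int_absorb2)
  finally have "AE t in circle. indicat_real N (cnj t) = 0"
    by (subst (asm) integral_nonneg_eq_0_iff_AE)
       (auto intro!: circle.integrable_const_bound[of _ 1])
  then show ?thesis
    using AE_space
  proof eventually_elim
    case (elim t)
    then have "cnj t \<notin> N" "cnj t \<in> space circle" by (auto simp: indicator_def split: if_splits)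
    then show ?case using N(1) by blast
  qed
qed

lemma continuous_integrable_circle:
  fixes f :: "complex \<Rightarrow> 'b::{banach, second_countable_topology}"
  assumes "continuous_on (sphere 0 1) f"
  shows "integrable circle f"
proof -
  have "compact (f ` sphere 0 1)"
    by (rule compact_continuous_image[OF assms]) simp
  then have "\<exists>B. \<forall>t\<in>sphere 0 1. norm (f t) \<le> B"
    by (auto dest!: compact_imp_bounded simp: bounded_iff)
  then obtain B where "\<And>t. t \<in> sphere 0 1 \<Longrightarrow> norm (f t) \<le> B"
    by blast
  then show ?thesis
    by (intro circle.integrable_const_bound[of _ B] AE_I2 borel_measurable_circle_continuous[OF assms])
       auto
qed

text \<open>Cauchy's integral formula at the centre: the derivative of the path is
  \<open>2 pi i\<close> times its value, which cancels the denominator. Boundary values enter only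
  through continuity, so branches of non-integral powers are admissible.\<close>

lemma mean_value_circle:
  assumes "continuous_on (cball 0 1) f" "f holomorphic_on ball 0 1"
  shows "(LINT t|circle. f t) = f 0"
proof -
  have c: "continuous_on (sphere 0 1) f"
    by (rule continuous_on_subset[OF assms(1)]) auto
  have cc: "continuous_on {0..1::real} (\<lambda>x. f (cis (2 * pi * x)))"
    by (intro continuous_on_compose2[OF c] continuous_intros) auto
  have c0: "inverse (2 * of_real pi * \<i>) * (2 * of_real pi * \<i> * z) = z" for z :: complex
    by (simp add: field_simps)
  have cis': "exp (2 * complex_of_real pi * \<i> * complex_of_real x) = cis (2 * pi * x)" for x
    by (simp add: cis_conv_exp algebra_simps)
  have "((\<lambda>u. f u / (u - 0)) has_contour_integral (2 * of_real pi * \<i> * f 0)) (circlepath 0 1)"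
    using assms by (intro Cauchy_integral_circlepath) auto
  then have "((\<lambda>x. (2 * of_real pi * \<i>) * f (cis (2 * pi * x))) has_integral (2 * of_real pi * \<i> * f 0)) {0..1}"
    unfolding has_contour_integral_def
  proof (rule has_integral_eq[rotated])
    fix x :: real assume "x \<in> {0..1}"
    then have "vector_derivative (circlepath 0 1) (at x within {0..1}) = 2 * of_real pi * \<i> * cis (2 * pi * x)"
      using vector_derivative_circlepath01[of x 0 1] by (simp add: cis')
    then show "f (circlepath 0 1 x) / (circlepath 0 1 x - 0) *
         vector_derivative (circlepath 0 1) (at x within {0..1}) =
         2 * complex_of_real pi * \<i> * f (cis (2 * pi * x))"
      by (simp add: circlepath cis')
  qed
  then have "((\<lambda>x. inverse (2 * of_real pi * \<i>) * ((2 * of_real pi * \<i>) * f (cis (2 * pi * x)))) has_integral inverse (2 * of_real pi * \<i>) * (2 * of_real pi * \<i> * f 0)) {0..1}"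
    by (rule has_integral_mult_right)
  then have "((\<lambda>x. f (cis (2 * pi * x))) has_integral f 0) {0..1}"
    by (simp only: c0)
  moreover have "((\<lambda>x. f (cis (2 * pi * x))) has_integral (LINT x:{0..1}|lborel. f (cis (2 * pi * x)))) {0..1}"
    using set_borel_integral_eq_integral[OF borel_integrable_atLeastAtMost'[OF cc]]
    by (simp add: integrable_integral)
  ultimately have "f 0 = (LINT x:{0..1}|lborel. f (cis (2 * pi * x)))"
    by (rule has_integral_unique)
  also have "\<dots> = (LINT x|lborel. indicat_real {0..<1} x *\<^sub>R f (cis (2 * pi * x)))"
    unfolding set_lebesgue_integral_def
  proof (rule integral_cong_AE)
    show m: "(\<lambda>x. indicat_real {0..1} x *\<^sub>R f (cis (2 * pi * x))) \<in> borel_measurable lborel"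
      using borel_integrable_atLeastAtMost'[OF cc] unfolding set_integrable_def by auto
    have "(\<lambda>x. indicat_real {0..<1} x *\<^sub>R (indicat_real {0..1} x *\<^sub>R f (cis (2 * pi * x)))) \<in> borel_measurable lborel"
      by (intro borel_measurable_scaleR m) simp
    also have "(\<lambda>x. indicat_real {0..<1} x *\<^sub>R (indicat_real {0..1} x *\<^sub>R f (cis (2 * pi * x)))) = (\<lambda>x. indicat_real {0..<1} x *\<^sub>R f (cis (2 * pi * x)))"
      by (auto split: split_indicator)
    finally show "(\<lambda>x. indicat_real {0..<1} x *\<^sub>R f (cis (2 * pi * x))) \<in> borel_measurable lborel" .
    have "AE x in lborel. x \<noteq> (1::real)" by (rule AE_lborel_singleton)
    then show "AE x in lborel. indicat_real {0..1} x *\<^sub>R f (cis (2 * pi * x)) =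
       indicat_real {0..<1} x *\<^sub>R f (cis (2 * pi * x))"
      by eventually_elim (auto split: split_indicator)
  qed
  also have "\<dots> = (LINT t|circle. f t)"
    by (rule integral_circle[symmetric]) (rule borel_measurable_circle_continuous[OF c])
  finally show ?thesis by simp
qed

section \<open>Elementary properties of \<open>L\<^sup>p\<close> and Fourier coefficients\<close>

text \<open>The p-th power of the norm. Convergence and boundedness need no sharp triangle
  inequality, so the elementary estimate with the factor \<open>2 powr p\<close> takes the place of
  Minkowski's inequality throughout.\<close>

definition Lp_pow :: "real \<Rightarrow> (complex \<Rightarrow> complex) \<Rightarrow> real" where
  "Lp_pow p f = (LINT t|circle. norm (f t) powr p)"

lemma Lp_pow_nonneg: "0 \<le> Lp_pow p f"
  unfolding Lp_pow_def by (rule integral_nonneg_AE) simp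

lemma norm_add_powr_le:
  fixes x y :: "'a::real_normed_vector"
  assumes "0 \<le> p"
  shows "norm (x + y) powr p \<le> 2 powr p * (norm x powr p + norm y powr p)"
proof -
  have "norm (x + y) \<le> 2 * max (norm x) (norm y)"
    using norm_triangle_ineq[of x y] by linarith
  then have "norm (x + y) powr p \<le> (2 * max (norm x) (norm y)) powr p"
    by (rule powr_mono2[OF assms norm_ge_zero])
  also have "\<dots> = 2 powr p * max (norm x) (norm y) powr p"
    by (rule powr_mult)
  also have "max (norm x) (norm y) powr p \<le> norm x powr p + norm y powr p"
    by (auto simp: max_def)
  finally show ?thesis by simp
qed

lemma Lp_measurable: "f \<in> Lp p \<Longrightarrow> f \<in> borel_measurable circle"
  by (simp add: Lp_def)

lemma Lp_integrable_powr: "f \<in> Lp p \<Longrightarrow> integrable circle (\<lambda>t. norm (f t) powr p)"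
  by (simp add: Lp_def)

lemma LpI_bound:
  assumes "f \<in> borel_measurable circle" "integrable circle g"
    "AE t in circle. norm (f t) powr p \<le> g t"
  shows "f \<in> Lp p"
  using assms(1) unfolding Lp_def
  by (auto intro!: Bochner_Integration.integrable_bound[OF assms(2)] simp: assms(3)
      intro: eventually_mono[OF assms(3)])

lemma Lp_pow_mono:
  assumes "f \<in> Lp p" "integrable circle g" "AE t in circle. norm (f t) powr p \<le> g t"
  shows "Lp_pow p f \<le> (LINT t|circle. g t)"
  unfolding Lp_pow_def using assms by (intro integral_mono_AE) (auto simp: Lp_def)

lemma Lp_add:
  assumes "0 \<le> p" "f \<in> Lp p" "g \<in> Lp p"
  shows "(\<lambda>t. f t + g t) \<in> Lp p"
    and "Lp_pow p (\<lambda>t. f t + g t) \<le> 2 powr p * (Lp_pow p f + Lp_pow p g)"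
proof -
  have i: "integrable circle (\<lambda>t. 2 powr p * (norm (f t) powr p + norm (g t) powr p))"
    using assms by (intro integrable_mult_right Bochner_Integration.integrable_add Lp_integrable_powr)
  show *: "(\<lambda>t. f t + g t) \<in> Lp p"
    using assms(2,3)[THEN Lp_measurable]
    by (intro LpI_bound[OF _ i]) (auto simp: norm_add_powr_le[OF assms(1)])
  show "Lp_pow p (\<lambda>t. f t + g t) \<le> 2 powr p * (Lp_pow p f + Lp_pow p g)"
    using Lp_pow_mono[OF * i] assms(2,3)[THEN Lp_integrable_powr]
    by (auto simp: norm_add_powr_le[OF assms(1)] Lp_pow_def)
qed

lemma Lp_scale:
  assumes "f \<in> Lp p"
  shows "(\<lambda>t. c * f t) \<in> Lp p" and "Lp_pow p (\<lambda>t. c * f t) = norm c powr p * Lp_pow p f"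
  using assms by (auto simp: Lp_def Lp_pow_def norm_mult powr_mult)

lemma Lp_uminus:
  assumes "f \<in> Lp p"
  shows "(\<lambda>t. - f t) \<in> Lp p" and "Lp_pow p (\<lambda>t. - f t) = Lp_pow p f"
  using assms by (auto simp: Lp_def Lp_pow_def)

lemma Lp_diff:
  assumes "0 \<le> p" "f \<in> Lp p" "g \<in> Lp p"
  shows "(\<lambda>t. f t - g t) \<in> Lp p"
    and "Lp_pow p (\<lambda>t. f t - g t) \<le> 2 powr p * (Lp_pow p f + Lp_pow p g)"
  using Lp_add[OF assms(1,2) Lp_uminus(1)[OF assms(3)]] Lp_uminus(2)[OF assms(3)] by auto

lemma Lp_pow_diff_commute: "Lp_pow p (\<lambda>t. f t - g t) = Lp_pow p (\<lambda>t. g t - f t)"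
  by (simp add: Lp_pow_def norm_minus_commute)

lemma Lp_pow_triangle:
  assumes "0 \<le> p" "f \<in> Lp p" "g \<in> Lp p" "h \<in> Lp p"
  shows "Lp_pow p (\<lambda>t. f t - h t) \<le> 2 powr p * (Lp_pow p (\<lambda>t. f t - g t) + Lp_pow p (\<lambda>t. g t - h t))"
  using Lp_add(2)[OF assms(1) Lp_diff(1)[OF assms(1,2,3)] Lp_diff(1)[OF assms(1,3,4)]] by simp

lemma Lp_zero: "(\<lambda>t. 0) \<in> Lp p"
  by (simp add: Lp_def)

lemma Lp_sum:
  assumes "0 \<le> p" "\<And>i. i \<in> I \<Longrightarrow> f i \<in> Lp p"
  shows "(\<lambda>t. \<Sum>i\<in>I. f i t) \<in> Lp p"
  using assms by (induction I rule: infinite_finite_induct) (auto simp: Lp_zero intro!: Lp_add)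

lemma Lp_cong_AE:
  assumes "f \<in> Lp p" "g \<in> borel_measurable circle" "AE t in circle. f t = g t"
  shows "g \<in> Lp p" and "Lp_pow p f = Lp_pow p g"
proof -
  have *: "AE t in circle. norm (g t) powr p \<le> norm (f t) powr p"
    using assms(3) by eventually_elim simp
  show "g \<in> Lp p"
    by (rule LpI_bound[OF assms(2) Lp_integrable_powr[OF assms(1)] *])
  show "Lp_pow p f = Lp_pow p g"
    unfolding Lp_pow_def using assms(3) assms(2) Lp_measurable[OF assms(1)]
    by (intro integral_cong_AE) auto
qed

lemma Lp_pow_eq_0_iff:
  assumes "f \<in> Lp p"
  shows "Lp_pow p f = 0 \<longleftrightarrow> (AE t in circle. f t = 0)"
  unfolding Lp_pow_def
  by (subst integral_nonneg_eq_0_iff_AE) (auto simp: Lp_integrable_powr[OF assms])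

lemma Lp_Linf:
  assumes "0 \<le> p" "f \<in> Linf" shows "f \<in> Lp p"
proof -
  obtain C where C: "AE t in circle. norm (f t) \<le> C" using assms by (auto simp: Linf_def)
  have "AE t in circle. norm (f t) powr p \<le> C powr p"
    using C by eventually_elim (use assms in \<open>auto intro: powr_mono2\<close>)
  then show ?thesis
    using assms by (intro LpI_bound[where g = "\<lambda>_. C powr p"]) (auto simp: Linf_def)
qed

lemma Linf_continuous:
  assumes "continuous_on (sphere 0 1) f" shows "f \<in> Linf"
proof -
  have "compact (f ` sphere 0 1)"
    by (rule compact_continuous_image[OF assms]) simp
  then have "\<exists>B. \<forall>t\<in>sphere 0 1. norm (f t) \<le> B"
    by (auto dest!: compact_imp_bounded simp: bounded_iff)
  then obtain B where "\<forall>t\<in>sphere 0 1. norm (f t) \<le> B" by blast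
  then have "AE t in circle. norm (f t) \<le> B" by (intro AE_I2) simp
  then show ?thesis
    unfolding Linf_def using borel_measurable_circle_continuous[OF assms] by auto
qed

lemma Lp_continuous: "0 \<le> p \<Longrightarrow> continuous_on (sphere 0 1) f \<Longrightarrow> f \<in> Lp p"
  by (intro Lp_Linf Linf_continuous)

lemma Linf_mult: "a \<in> Linf \<Longrightarrow> b \<in> Linf \<Longrightarrow> (\<lambda>t. a t * b t) \<in> Linf"
proof -
  assume "a \<in> Linf" "b \<in> Linf"
  then obtain C D where *: "AE t in circle. norm (a t) \<le> C" "AE t in circle. norm (b t) \<le> D"
    and [measurable]: "a \<in> borel_measurable circle" "b \<in> borel_measurable circle"
    by (auto simp: Linf_def)
  have "AE t in circle. norm (a t * b t) \<le> \<bar>C\<bar> * \<bar>D\<bar>"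
    using * by eventually_elim (auto simp: norm_mult intro!: mult_mono)
  then show ?thesis unfolding Linf_def by auto
qed

lemma Lp_Linf_mult:
  assumes "0 \<le> p" "a \<in> Linf"
  obtains C where "0 \<le> C" "\<And>f. f \<in> Lp p \<Longrightarrow> (\<lambda>t. a t * f t) \<in> Lp p"
    "\<And>f. f \<in> Lp p \<Longrightarrow> Lp_pow p (\<lambda>t. a t * f t) \<le> C * Lp_pow p f"
proof -
  obtain C where C: "AE t in circle. norm (a t) \<le> C" using assms by (auto simp: Linf_def)
  have a: "a \<in> borel_measurable circle" using assms by (simp add: Linf_def)
  have b: "AE t in circle. norm (a t * f t) powr p \<le> C powr p * norm (f t) powr p" for f
    using C
  proof eventually_elim
    case (elim t)
    then have "0 \<le> C" using norm_ge_zero[of "a t"] by linarith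
    with elim show ?case using assms(1)
      by (simp add: norm_mult powr_mult mult_right_mono powr_mono2)
  qed
  show ?thesis
  proof (rule that[of "C powr p"])
    fix f assume f: "f \<in> Lp p"
    have i: "integrable circle (\<lambda>t. C powr p * norm (f t) powr p)"
      using Lp_integrable_powr[OF f] by simp
    show *: "(\<lambda>t. a t * f t) \<in> Lp p"
      using a Lp_measurable[OF f] by (intro LpI_bound[OF _ i b]) simp
    show "Lp_pow p (\<lambda>t. a t * f t) \<le> C powr p * Lp_pow p f"
      using Lp_pow_mono[OF * i b] by (simp add: Lp_pow_def)
  qed simp
qed

lemma Lp_mult_Linf: "0 \<le> p \<Longrightarrow> a \<in> Linf \<Longrightarrow> f \<in> Lp p \<Longrightarrow> (\<lambda>t. a t * f t) \<in> Lp p"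
  by (rule Lp_Linf_mult[of p a]) auto

lemma distr_circle_cnj: "distr circle circle cnj = circle"
proof (rule measure_eqI)
  fix A assume "A \<in> sets (distr circle circle cnj)"
  then have A [measurable]: "A \<in> sets circle" by simp
  have "measure circle A = (LINT t|circle. indicat_real A t)"
    using sets.sets_into_space[OF A] by (simp add: Int_absorb2)
  also have "\<dots> = (LINT t|circle. indicat_real A (cnj t))"
    by (rule integral_circle_cnj[symmetric]) measurable
  also have "\<dots> = (LINT t|circle. indicat_real (cnj -` A \<inter> space circle) t)"
    by (rule Bochner_Integration.integral_cong) (auto split: split_indicator)
  also have "\<dots> = measure circle (cnj -` A \<inter> space circle)"
    by simp
  finally show "emeasure (distr circle circle cnj) A = emeasure circle A"
    by (simp add: emeasure_distr circle.emeasure_eq_measure)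
qed simp

lemma Lp_cnj_arg:
  assumes "f \<in> Lp p"
  shows "(\<lambda>t. f (cnj t)) \<in> Lp p" "Lp_pow p (\<lambda>t. f (cnj t)) = Lp_pow p f"
proof -
  have [measurable]: "f \<in> borel_measurable circle" by (rule Lp_measurable[OF assms])
  have "integrable (distr circle circle cnj) (\<lambda>t. norm (f t) powr p)"
    using Lp_integrable_powr[OF assms] by (simp add: distr_circle_cnj)
  then have "integrable circle (\<lambda>t. norm (f (cnj t)) powr p)"
    by (subst (asm) integrable_distr_eq) auto
  then show "(\<lambda>t. f (cnj t)) \<in> Lp p" by (simp add: Lp_def)
  show "Lp_pow p (\<lambda>t. f (cnj t)) = Lp_pow p f"
    unfolding Lp_pow_def by (rule integral_circle_cnj[of "\<lambda>t. norm (f t) powr p"]) measurable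
qed

text \<open>If \<open>x > e\<close> then \<open>(x / e) powr (p - 1) \<ge> 1\<close>, and
  multiplying by \<open>x\<close> gives the second summand. With the parameter \<open>e\<close> left
  free, this replaces Hoelder's inequality in the embedding of \<open>L^p\<close> into
  \<open>L^1\<close>.\<close>

lemma le_eps_powr:
  fixes x :: real
  assumes "1 \<le> p" "0 < e" "0 \<le> x"
  shows "x \<le> e + e powr (1 - p) * x powr p"
proof (cases "x \<le> e")
  case False
  then have "e powr (p - 1) \<le> x powr (p - 1)"
    using assms by (intro powr_mono2) auto
  then have "e powr (1 - p) * e powr (p - 1) * x \<le> e powr (1 - p) * x powr (p - 1) * x"
    using assms by (intro mult_right_mono mult_left_mono) auto
  moreover have "e powr (1 - p) * e powr (p - 1) = 1" using assms by (simp flip: powr_add)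
  moreover have "x powr (p - 1) * x = x powr p"
    using powr_mult_base[of x "p - 1"] assms by (simp add: mult.commute)
  ultimately show ?thesis using assms by (simp add: mult.assoc)
qed (simp add: add_increasing2)

lemma Lp_integrable:
  assumes "1 \<le> p" "f \<in> Lp p" shows "integrable circle f"
    and "0 < e \<Longrightarrow> (LINT t|circle. norm (f t)) \<le> e + e powr (1 - p) * Lp_pow p f"
proof -
  have i: "integrable circle (\<lambda>t. e + e powr (1 - p) * norm (f t) powr p)" for e
    using Lp_integrable_powr[OF assms(2)] by simp
  show *: "integrable circle f"
    by (rule Bochner_Integration.integrable_bound[OF i[of 1]])
       (use le_eps_powr[OF assms(1), of 1] Lp_measurable[OF assms(2)] in auto)
  show "(LINT t|circle. norm (f t)) \<le> e + e powr (1 - p) * Lp_pow p f" if "0 < e"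
  proof -
    have "(LINT t|circle. norm (f t)) \<le> (LINT t|circle. e + e powr (1 - p) * norm (f t) powr p)"
      by (rule integral_mono_AE[OF integrable_norm[OF *] i])
         (use le_eps_powr[OF assms(1) that] in auto)
    also have "\<dots> = e + e powr (1 - p) * Lp_pow p f"
      using Lp_integrable_powr[OF assms(2)] by (simp add: Lp_pow_def)
    finally show ?thesis .
  qed
qed

lemma Lp_pow_tendsto_0_imp_L1:
  assumes "1 \<le> p" "\<And>k. f k \<in> Lp p" "(\<lambda>k. Lp_pow p (f k)) \<longlonglongrightarrow> 0"
  shows "(\<lambda>k. LINT t|circle. norm (f k t)) \<longlonglongrightarrow> 0"
  unfolding tendsto_iff
proof (intro allI impI)
  fix e :: real assume "e > 0"
  have "(\<lambda>k. (e/2) powr (1 - p) * Lp_pow p (f k)) \<longlonglongrightarrow> (e/2) powr (1 - p) * 0"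
    by (intro tendsto_intros assms)
  then have "\<forall>\<^sub>F k in sequentially. (e/2) powr (1 - p) * Lp_pow p (f k) < e / 2"
    by (rule order_tendstoD(2)) (use \<open>e > 0\<close> in simp)
  then show "\<forall>\<^sub>F k in sequentially. dist (LINT t|circle. norm (f k t)) 0 < e"
  proof eventually_elim
    case (elim k)
    have "0 \<le> (LINT t|circle. norm (f k t))" by (rule integral_nonneg_AE) simp
    then show ?case
      using Lp_integrable(2)[OF assms(1,2), of "e/2" k] elim \<open>e > 0\<close> by simp
  qed
qed

lemma Lp_tendsto_integral:
  assumes "1 \<le> p" "\<And>k. f k \<in> Lp p" "g \<in> Lp p"
    "(\<lambda>k. Lp_pow p (\<lambda>t. f k t - g t)) \<longlonglongrightarrow> 0"
  shows "(\<lambda>k. LINT t|circle. f k t) \<longlonglongrightarrow> (LINT t|circle. g t)"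
proof -
  have d: "(\<lambda>t. f k t - g t) \<in> Lp p" for k using assms by (intro Lp_diff) auto
  have "(\<lambda>k. LINT t|circle. norm (f k t - g t)) \<longlonglongrightarrow> 0"
    by (rule Lp_pow_tendsto_0_imp_L1[OF assms(1) d assms(4)])
  then have "(\<lambda>k. (LINT t|circle. f k t) - (LINT t|circle. g t)) \<longlonglongrightarrow> 0"
  proof (rule Lim_null_comparison[rotated], intro always_eventually allI)
    fix k
    have "(LINT t|circle. f k t) - (LINT t|circle. g t) = (LINT t|circle. f k t - g t)"
      using assms by (intro Bochner_Integration.integral_diff[symmetric] Lp_integrable(1))
    then show "norm ((LINT t|circle. f k t) - (LINT t|circle. g t)) \<le> (LINT t|circle. norm (f k t - g t))"
      using integral_norm_bound[of circle "\<lambda>t. f k t - g t"] by simp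
  qed
  then show ?thesis by (rule Lim_null[THEN iffD2])
qed

section \<open>Fourier coefficients: linearity, shift, reflection and continuity\<close>

lemma Linf_powi: "(\<lambda>t. t powi n) \<in> Linf"
  by (intro Linf_continuous continuous_intros) auto

lemma Linf_id: "(\<lambda>t. t) \<in> Linf" and Linf_cnj: "cnj \<in> Linf"
  by (intro Linf_continuous continuous_intros)+

lemma Lp_powi_mult: "0 \<le> p \<Longrightarrow> f \<in> Lp p \<Longrightarrow> (\<lambda>t. t powi n * f t) \<in> Lp p"
  by (rule Lp_mult_Linf[OF _ Linf_powi])

lemma fourier_coeff_integrable:
  assumes "1 \<le> p" "f \<in> Lp p"
  shows "integrable circle (\<lambda>t. f t * t powi n)"
  using Lp_integrable(1)[OF assms(1) Lp_powi_mult[OF _ assms(2)]] assms(1) by (simp add: mult.commute)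

lemma fourier_coeff_tendsto:
  assumes "1 \<le> p" "\<And>k. f k \<in> Lp p" "g \<in> Lp p"
    "(\<lambda>k. Lp_pow p (\<lambda>t. f k t - g t)) \<longlonglongrightarrow> 0"
  shows "(\<lambda>k. fourier_coeff (f k) n) \<longlonglongrightarrow> fourier_coeff g n"
  unfolding fourier_coeff_def mult.commute[of _ "_ powi _"]
proof (rule Lp_tendsto_integral[OF assms(1)])
  have p: "0 \<le> p" using assms(1) by simp
  show "(\<lambda>t. t powi - n * f k t) \<in> Lp p" "(\<lambda>t. t powi - n * g t) \<in> Lp p" for k
    by (intro Lp_powi_mult p assms)+
  have "Lp_pow p (\<lambda>t. t powi - n * f k t - t powi - n * g t) = Lp_pow p (\<lambda>t. f k t - g t)" for k
    unfolding Lp_pow_def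
    by (intro Bochner_Integration.integral_cong)
       (auto simp: norm_mult norm_power_int simp flip: right_diff_distrib)
  then show "(\<lambda>k. Lp_pow p (\<lambda>t. t powi - n * f k t - t powi - n * g t)) \<longlonglongrightarrow> 0"
    using assms(4) by simp
qed

lemma fourier_coeff_add:
  assumes "1 \<le> p" "f \<in> Lp p" "g \<in> Lp p"
  shows "fourier_coeff (\<lambda>t. f t + g t) n = fourier_coeff f n + fourier_coeff g n"
  using assms by (simp add: fourier_coeff_def distrib_right fourier_coeff_integrable[OF assms(1)])

lemma fourier_coeff_scale: "fourier_coeff (\<lambda>t. c * f t) n = c * fourier_coeff f n"
  by (simp add: fourier_coeff_def mult.assoc)

lemma fourier_coeff_diff:
  assumes "1 \<le> p" "f \<in> Lp p" "g \<in> Lp p"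
  shows "fourier_coeff (\<lambda>t. f t - g t) n = fourier_coeff f n - fourier_coeff g n"
  using assms by (simp add: fourier_coeff_def left_diff_distrib fourier_coeff_integrable[OF assms(1)])

lemma fourier_coeff_zero: "fourier_coeff (\<lambda>t. 0) n = 0"
  by (simp add: fourier_coeff_def)

lemma fourier_coeff_sum:
  assumes "1 \<le> p" "\<And>i. i \<in> I \<Longrightarrow> f i \<in> Lp p"
  shows "fourier_coeff (\<lambda>t. \<Sum>i\<in>I. f i t) n = (\<Sum>i\<in>I. fourier_coeff (f i) n)"
  using assms
proof (induction I rule: infinite_finite_induct)
  case (insert i I)
  then have "(\<lambda>t. \<Sum>i\<in>I. f i t) \<in> Lp p" by (intro Lp_sum) auto
  with insert show ?case by (simp add: fourier_coeff_add[OF assms(1)])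
qed (simp_all add: fourier_coeff_zero)

lemma fourier_coeff_cong_AE:
  assumes "f \<in> borel_measurable circle" "g \<in> borel_measurable circle" "AE t in circle. f t = g t"
  shows "fourier_coeff f n = fourier_coeff g n"
proof -
  have [measurable]: "(\<lambda>t. t powi - n) \<in> borel_measurable circle"
    using Linf_powi[of "-n"] by (simp add: Linf_def)
  show ?thesis
    unfolding fourier_coeff_def using assms
    by (intro integral_cong_AE) (auto elim: eventually_mono)
qed

lemma cnj_on_circle: "t \<in> sphere 0 1 \<Longrightarrow> cnj t = inverse t"
  by (simp add: divide_conv_cnj[of t 1, simplified] inverse_eq_divide)

lemma fourier_coeff_powi_mult: "fourier_coeff (\<lambda>t. t powi m * f t) n = fourier_coeff f (n - m)"
  unfolding fourier_coeff_def
proof (intro Bochner_Integration.integral_cong refl)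
  fix t assume "t \<in> space circle"
  then have "t \<noteq> 0" by auto
  then show "t powi m * f t * t powi - n = f t * t powi - (n - m)"
    by (simp add: power_int_add[symmetric] power_int_diff power_int_minus field_simps)
qed

lemma fourier_coeff_cnj_arg:
  assumes "f \<in> borel_measurable circle"
  shows "fourier_coeff (\<lambda>t. f (cnj t)) n = fourier_coeff f (- n)"
proof -
  have m: "(\<lambda>t. t powi n) \<in> borel_measurable circle"
    using Linf_powi[of n] by (simp add: Linf_def)
  have "fourier_coeff (\<lambda>t. f (cnj t)) n = (LINT t|circle. f (cnj t) * (cnj t) powi n)"
    unfolding fourier_coeff_def
  proof (intro Bochner_Integration.integral_cong refl)
    fix t assume "t \<in> space circle"
    then have "cnj t = inverse t" by (simp add: cnj_on_circle)
    then show "f (cnj t) * t powi - n = f (cnj t) * cnj t powi n"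
      by (simp add: power_int_minus power_int_inverse)
  qed
  also have "\<dots> = (LINT t|circle. f t * t powi n)"
    by (intro integral_circle_cnj[of "\<lambda>t. f t * t powi n"] borel_measurable_times m assms)
  finally show ?thesis by (simp add: fourier_coeff_def)
qed

lemma integral_circle_powi: "(LINT t|circle. t powi n) = (if n = 0 then 1 else 0)"
proof -
  have pos: "(LINT t|circle. t powi n) = 0" if "n > 0" for n
    using that mean_value_circle[of "\<lambda>t. t ^ nat n"]
    by (simp add: power_int_def continuous_intros holomorphic_intros)
  have "(LINT t|circle. t powi n) = 0" if "n < 0"
  proof -
    have "(LINT t|circle. t powi n) = (LINT t|circle. (cnj t) powi (- n))"
      by (intro Bochner_Integration.integral_cong refl) (auto simp: cnj_on_circle power_int_inverse power_int_minus)
    also have "\<dots> = (LINT t|circle. t powi (- n))"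
      using Linf_powi[of "-n"] by (intro integral_circle_cnj[of "\<lambda>t. t powi (-n)"]) (simp add: Linf_def)
    finally show ?thesis using pos[of "-n"] that by simp
  qed
  then show ?thesis using pos[of n] by (cases n "0::int" rule: linorder_cases) auto
qed

lemma fourier_coeff_powi: "fourier_coeff (\<lambda>t. t powi m) n = (if n = m then 1 else 0)"
  using fourier_coeff_powi_mult[of m "\<lambda>_. 1" n] integral_circle_powi[of "m - n"]
  by (simp add: fourier_coeff_def)

section \<open>The inequality of M. Riesz for trigonometric polynomials\<close>

text \<open>Writing \<open>z = |z| exp(i phi)\<close> with \<open>|phi| < pi / 2\<close> reduces the
  claim to \<open>1 \<le> A (cos phi)^p - B cos(p phi)\<close>. Close to \<open>pi / 2\<close> the
  angle \<open>p phi\<close> lies in the second quadrant, where the second term alone suffices;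
  elsewhere \<open>cos phi\<close> is bounded away from 0 and the first term does. The second
  quadrant is not exceeded because \<open>p \<le> 2\<close>.\<close>

lemma half_plane_powr_inequality:
  fixes p :: real
  assumes p: "1 < p" "p \<le> 2"
  obtains A B :: real where "0 \<le> A" "1 \<le> B"
    "\<And>z. 0 < Re z \<Longrightarrow> norm z powr p \<le> A * Re z powr p - B * Re (exp (of_real p * Ln z))"
proof -
  \<comment> \<open>The threshold between the two regimes is the midpoint of
    \<open>pi / (2 p)\<close> and \<open>pi / 2\<close>, which gives
    \<open>pi / 2 < p \<theta>\<close> and still \<open>cos \<theta> > 0\<close>.\<close>
  define \<theta> where "\<theta> = (pi / 2 + pi / (2 * p)) / 2"
  have "0 < pi / (2 * p)" "pi / (2 * p) < pi / 2" using p by (simp_all add: field_simps)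
  then have \<theta>: "pi / (2 * p) < \<theta>" "\<theta> < pi / 2" "0 < \<theta>"
    by (simp_all add: \<theta>_def)
  have p\<theta>: "pi / 2 < p * \<theta>" using \<theta>(1) p by (simp add: field_simps)
  have p\<theta>': "p * \<theta> \<le> pi"
    using mult_mono[of p 2 \<theta> "pi / 2"] p \<theta> by simp
  define c where "c = - cos (p * \<theta>)"
  have c: "0 < c" "c \<le> 1"
    using cos_lt_zero_pi[of "p * \<theta>"] p\<theta> p\<theta>' cos_ge_minus_one[of "p * \<theta>"] 
    by (auto simp: c_def) 
  define d where "d = cos \<theta> powr p"
  have cos\<theta>: "0 < cos \<theta>" using \<theta> by (intro cos_gt_zero_pi) auto
  then have d: "0 < d" by (simp add: d_def)
  \<comment> \<open>\<open>B = 1 / c\<close> makes \<open>- B cos(p phi) \<ge> 1\<close> for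
    \<open>phi \<ge> \<theta>\<close>. For smaller angles \<open>(cos phi)^p \<ge> d\<close>, so
    \<open>A = (1 + B) / d\<close> outweighs the worst case \<open>B cos(p phi) = B\<close> and
    leaves 1.\<close>
  show ?thesis
  proof (rule that[of "(1 + 1 / c) / d" "1 / c"])
    show "0 \<le> (1 + 1 / c) / d" "1 \<le> 1 / c" using c d by auto
    fix z :: complex assume z: "0 < Re z"
    then have z0: "z \<noteq> 0" by auto
    define \<phi> where "\<phi> = \<bar>Im (Ln z)\<bar>"
    have \<phi>: "\<phi> < pi / 2" "0 \<le> \<phi>" using Re_Ln_pos_lt[OF z0] z by (auto simp: \<phi>_def)
    have nz: "norm z = exp (Re (Ln z))" using z0 by (simp flip: norm_exp_eq_Re)
    have "Re z = Re (exp (Ln z))" using z0 by simp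
    also have "\<dots> = norm z * cos \<phi>" by (simp add: Re_exp nz \<phi>_def)
    finally have Rz: "Re z = norm z * cos \<phi>" .
    have "Re (exp (of_real p * Ln z)) = exp (p * Re (Ln z)) * cos (p * Im (Ln z))"
      by (simp add: Re_exp)
    also have "exp (p * Re (Ln z)) = norm z powr p" by (simp add: nz powr_def)
    also have "cos (p * Im (Ln z)) = cos (p * \<phi>)"
      unfolding \<phi>_def using p by (cases "Im (Ln z) \<ge> 0") auto
    finally have Rp: "Re (exp (of_real p * Ln z)) = norm z powr p * cos (p * \<phi>)" .
    have cos\<phi>: "0 < cos \<phi>" using \<phi> by (intro cos_gt_zero_pi) auto
    have "1 \<le> (1 + 1 / c) / d * cos \<phi> powr p - 1 / c * cos (p * \<phi>)"
    proof (cases "\<theta> \<le> \<phi>")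
      case True
      then have "p * \<theta> \<le> p * \<phi>" using p by simp
      moreover have "p * \<phi> \<le> pi"
        using mult_mono[of p 2 \<phi> "pi / 2"] p \<phi> by simp
      ultimately have "cos (p * \<phi>) \<le> - c"
        using cos_monotone_0_pi_le[of "p * \<theta>" "p * \<phi>"] p \<theta> by (simp add: c_def)
      then have "1 \<le> - (1 / c * cos (p * \<phi>))" using c by (simp add: field_simps)
      moreover have "0 \<le> (1 + 1 / c) / d * cos \<phi> powr p" using c d by simp
      ultimately show ?thesis by linarith
    next
      case False
      then have "cos \<theta> \<le> cos \<phi>" using \<phi> \<theta> by (intro cos_monotone_0_pi_le) auto
      then have "d \<le> cos \<phi> powr p" using cos\<theta> p by (auto simp: d_def intro!: powr_mono2)
      then have "(1 + 1 / c) / d * d \<le> (1 + 1 / c) / d * cos \<phi> powr p"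
        using c d by (intro mult_left_mono) auto
      then have "1 + 1 / c \<le> (1 + 1 / c) / d * cos \<phi> powr p" using d by simp
      moreover have "1 / c * cos (p * \<phi>) \<le> 1 / c" using c by (simp add: field_simps)
      ultimately show ?thesis by linarith
    qed
    then have "norm z powr p * 1 \<le> norm z powr p * ((1 + 1 / c) / d * cos \<phi> powr p - 1 / c * cos (p * \<phi>))"
      by (intro mult_left_mono) auto
    also have "\<dots> = (1 + 1 / c) / d * Re z powr p - 1 / c * Re (exp (of_real p * Ln z))"
      unfolding Rz Rp by (simp add: powr_mult algebra_simps)
    finally show "norm z powr p \<le> (1 + 1 / c) / d * Re z powr p - 1 / c * Re (exp (of_real p * Ln z))"
      by simp
  qed
qed

text \<open>The half-plane inequality is integrated along the circle. The mean of the holomorphic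
  branch of \<open>s^p\<close> is its value at 0, where \<open>s\<close> is real and positive; since
  \<open>B \<ge> 1\<close>, this contributes a full \<open>|s(0)|^p\<close> on the left. That extra
  term pays for the constant in the analytic part \<open>(s + s(0)) / 2\<close> of
  \<open>Re s\<close>.\<close>

lemma poly_Re_pos_bound:
  fixes p :: real
  assumes p: "1 < p" "p \<le> 2"
  obtains A where "0 \<le> A"
    "\<And>s. \<lbrakk>Im (poly s 0) = 0; \<And>t. t \<in> sphere 0 1 \<Longrightarrow> 0 < Re (poly s t)\<rbrakk> \<Longrightarrow>
       Lp_pow p (poly s) + norm (poly s 0) powr p \<le> A * (LINT t|circle. Re (poly s t) powr p)"
proof -
  obtain A B :: real where AB: "0 \<le> A" "1 \<le> B"
    "\<And>z. 0 < Re z \<Longrightarrow> norm z powr p \<le> A * Re z powr p - B * Re (exp (of_real p * Ln z))"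
    using half_plane_powr_inequality[OF p] by metis
  show ?thesis
  proof (rule that[OF AB(1)])
    fix s :: "complex poly"
    assume im: "Im (poly s 0) = 0" and pos: "\<And>t. t \<in> sphere 0 1 \<Longrightarrow> 0 < Re (poly s t)"
    have cont: "continuous_on X (\<lambda>t. Re (poly s t))" for X by (intro continuous_intros)
    obtain t0 where t0: "t0 \<in> sphere 0 1" "\<And>t. t \<in> sphere 0 1 \<Longrightarrow> Re (poly s t0) \<le> Re (poly s t)"
      using continuous_attains_inf[of "sphere 0 1 :: complex set" "\<lambda>t. Re (poly s t)"] cont
      by (auto simp del: mem_sphere_0)
    \<comment> \<open>The maximum principle for \<open>- Re s\<close> carries the positive minimum
      over the circle into the disc, where the branch of the logarithm is needed.\<close>
    have pos_disc: "0 < Re (poly s z)" if "z \<in> cball 0 1" for z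
    proof -
      have "Re (- poly s z) \<le> - Re (poly s t0)"
        by (rule maximum_real_frontier[of _ "cball 0 1"])
           (use that t0(2) in \<open>auto intro!: holomorphic_intros continuous_intros\<close>)
      then show ?thesis using pos[OF t0(1)] by simp
    qed
    define F where "F = (\<lambda>z. exp (of_real p * Ln (poly s z)))"
    have nonpos: "poly s z \<notin> \<real>\<^sub>\<le>\<^sub>0" if "z \<in> cball 0 1" for z
      using pos_disc[OF that] by (auto simp: complex_nonpos_Reals_iff)
    have contF: "continuous_on (cball 0 1) F"
      unfolding F_def by (intro continuous_intros) (use nonpos in auto)
    have holF: "F holomorphic_on ball 0 1"
      unfolding F_def by (intro holomorphic_intros) (use nonpos in auto)
    have mv: "(LINT t|circle. F t) = F 0" by (rule mean_value_circle[OF contF holF])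
    have iF: "integrable circle F"
      by (intro continuous_integrable_circle continuous_on_subset[OF contF]) auto
    have s0: "0 < Re (poly s 0)" using pos_disc[of 0] by simp
    have s0': "poly s 0 = of_real (Re (poly s 0))" using im by (simp add: complex_eq_iff)
    have "F 0 = of_real (Re (poly s 0) powr p)"
      unfolding F_def by (subst s0') (use s0 in \<open>simp add: Ln_of_real powr_def exp_of_real flip: of_real_mult\<close>)
    then have F0: "Re (F 0) = norm (poly s 0) powr p"
      by (subst s0') (use s0 in simp)
    have powi: "integrable circle (\<lambda>t. Re (poly s t) powr p)"
      by (intro continuous_integrable_circle continuous_intros) (use pos in force)+
    have "Lp_pow p (poly s) \<le> (LINT t|circle. A * Re (poly s t) powr p - B * Re (F t))"
    proof (rule Lp_pow_mono)
      show "poly s \<in> Lp p" using p by (intro Lp_continuous continuous_intros) auto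
      show "integrable circle (\<lambda>t. A * Re (poly s t) powr p - B * Re (F t))"
        using powi iF by (intro Bochner_Integration.integrable_diff integrable_mult_right integrable_Re)
      show "AE t in circle. norm (poly s t) powr p \<le> A * Re (poly s t) powr p - B * Re (F t)"
        using AB(3) pos by (intro AE_I2) (auto simp: F_def)
    qed
    also have "\<dots> = A * (LINT t|circle. Re (poly s t) powr p) - B * Re (LINT t|circle. F t)"
      using powi iF by (simp add: integrable_Re)
    also have "\<dots> \<le> A * (LINT t|circle. Re (poly s t) powr p) - norm (poly s 0) powr p"
      using mult_right_mono[OF AB(2), of "norm (poly s 0) powr p"] by (simp add: mv F0)
    finally show "Lp_pow p (poly s) + norm (poly s 0) powr p \<le> A * (LINT t|circle. Re (poly s t) powr p)"
      by simp
  qed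
qed

section \<open>Real parts of polynomials on the circle and their analytic parts\<close>

lemma cnj_poly_cnj: "\<exists>r'. \<forall>t. cnj (poly r (cnj t)) = poly r' t"
proof (induction r)
  case (pCons a r)
  then obtain r' where "\<forall>t. cnj (poly r (cnj t)) = poly r' t" by blast
  then show ?case by (intro exI[of _ "pCons (cnj a) r'"]) simp
qed (auto intro: exI[of _ 0])

text \<open>When both factors are \<open>constant + t * rest\<close>, the relation
  \<open>t * cnj t = 1\<close> reduces the product of the two tails to the same problem in lower
  degree; each remaining term, or its conjugate, is already a polynomial in \<open>t\<close>, and
  conjugation does not change the real part.\<close>

lemma Re_mult_cnj_poly:
  "\<exists>s. \<forall>t\<in>sphere 0 1. Re (poly q t * cnj (poly r t)) = Re (poly s t)"
proof (induction q r rule: poly_induct2)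
  case 0
  show ?case by (intro exI[of _ 0]) simp
next
  case (pCons a q b r)
  then obtain s where s: "\<And>t. t \<in> sphere 0 1 \<Longrightarrow> Re (poly q t * cnj (poly r t)) = Re (poly s t)"
    by blast
  have "Re (poly (pCons a q) t * cnj (poly (pCons b r) t)) =
      Re (poly ([:a * cnj b:] + smult (cnj a) (pCons 0 r) + smult (cnj b) (pCons 0 q) + s) t)"
    if t: "t \<in> sphere 0 1" for t
  proof -
    have tt: "t * cnj t = 1" using t by (simp add: complex_norm_square[symmetric])
    define w where "w = poly q t * cnj (poly r t)"
    have "poly (pCons a q) t * cnj (poly (pCons b r) t) =
      a * cnj b + cnj (cnj a * (t * poly r t)) + cnj b * (t * poly q t) + (t * cnj t) * w"
      by (simp add: w_def algebra_simps)
    then have "Re (poly (pCons a q) t * cnj (poly (pCons b r) t)) =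
        Re (a * cnj b) + Re (cnj a * (t * poly r t)) + Re (cnj b * (t * poly q t)) + Re w"
      unfolding tt mult_1_left by (simp only: plus_complex.sel cnj.sel)
    also have "Re w = Re (poly s t)" unfolding w_def by (rule s[OF t])
    finally show ?thesis by (simp only: poly_add poly_smult poly_pCons poly_0 plus_complex.sel) simp
  qed
  then show ?case by blast
qed

lemma real_polynomial_on_circle:
  assumes "real_polynomial_function g"
  shows "\<exists>s. \<forall>t\<in>sphere 0 (1::real). g t = Re (poly s t)"
  using assms
proof (induction rule: real_polynomial_function.induct)
  case (linear f)
  interpret f: bounded_linear f by fact
  have "f t = Re (poly [:0, of_real (f 1) - \<i> * of_real (f \<i>):] t)" for t
  proof -
    have "t = Re t *\<^sub>R 1 + Im t *\<^sub>R \<i>" by (simp add: complex_eq_iff)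
    then have "f t = Re t * f 1 + Im t * f \<i>" by (metis f.add f.scaleR real_scaleR_def)
    then show ?thesis by simp
  qed
  then show ?case by blast
next
  case (const c)
  show ?case by (intro exI[of _ "[:of_real c:]"]) simp
next
  case (add f g)
  then obtain s s' where "\<forall>t\<in>sphere 0 1. f t = Re (poly s t)" "\<forall>t\<in>sphere 0 1. g t = Re (poly s' t)"
    by blast
  then show ?case by (intro exI[of _ "s + s'"]) simp
next
  case (mult f g)
  then obtain s s' where ss: "\<And>t. t\<in>sphere 0 1 \<Longrightarrow> f t = Re (poly s t)" "\<And>t. t\<in>sphere 0 1 \<Longrightarrow> g t = Re (poly s' t)"
    by blast
  obtain u where u: "\<And>t. t\<in>sphere 0 1 \<Longrightarrow> Re (poly s t * cnj (poly s' t)) = Re (poly u t)"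
    using Re_mult_cnj_poly by blast
  \<comment> \<open>This is \<open>Re u * Re v = (Re (u v) + Re (u cnj v)) / 2\<close>.\<close>
  have "f t * g t = Re (poly (smult (1/2) (s * s' + u)) t)" if "t\<in>sphere 0 1" for t
    using ss[OF that] u[OF that] by (simp add: field_simps)
  then show ?case by blast
qed

lemma continuous_approx_Re_poly:
  fixes \<phi> :: "complex \<Rightarrow> real"
  assumes "continuous_on (sphere 0 1) \<phi>" "0 < e"
  obtains s where "Im (poly s 0) = 0" "\<And>t. t \<in> sphere 0 1 \<Longrightarrow> \<bar>\<phi> t - Re (poly s t)\<bar> < e"
proof -
  obtain g where g: "real_polynomial_function g" "\<And>t. t \<in> sphere 0 1 \<Longrightarrow> \<bar>\<phi> t - g t\<bar> < e"
    using Stone_Weierstrass_real_polynomial_function[OF compact_sphere assms] by blast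
  obtain s where s: "\<And>t. t \<in> sphere 0 1 \<Longrightarrow> g t = Re (poly s t)"
    using real_polynomial_on_circle[OF g(1)] by blast
  \<comment> \<open>Subtracting an imaginary constant normalizes the value at 0 to be real and
    leaves the real part alone.\<close>
  show ?thesis
    by (rule that[of "s - [:\<i> * of_real (Im (poly s 0)):]"]) (use g(2) s in auto)
qed

text \<open>\<open>trig_poly q r\<close> has analytic part \<open>q(t)\<close> and, since \<open>cnj t = 1/t\<close> on the circle,
  antianalytic part \<open>t\<^sup>-\<^sup>1 r(t\<^sup>-\<^sup>1)\<close>.\<close>

definition trig_poly :: "complex poly \<Rightarrow> complex poly \<Rightarrow> complex \<Rightarrow> complex" where
  "trig_poly q r = (\<lambda>t. poly q t + cnj t * poly r (cnj t))"

lemma continuous_trig_poly: "continuous_on S (trig_poly q r)"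
  unfolding trig_poly_def by (intro continuous_intros)

lemma Lp_trig_poly: "0 \<le> p \<Longrightarrow> trig_poly q r \<in> Lp p"
  by (intro Lp_continuous continuous_trig_poly)

lemma Lp_poly: "0 \<le> p \<Longrightarrow> poly q \<in> Lp p" for q :: "complex poly"
  by (intro Lp_continuous continuous_intros)

lemma trig_poly_add: "trig_poly q r t + trig_poly q' r' t = trig_poly (q + q') (r + r') t"
  and trig_poly_diff: "trig_poly q r t - trig_poly q' r' t = trig_poly (q - q') (r - r') t"
  and trig_poly_smult: "c * trig_poly q r t = trig_poly (smult c q) (smult c r) t"
  by (simp_all add: trig_poly_def algebra_simps)

text \<open>In \<open>Re s = (s + cnj s) / 2\<close> the conjugate is a polynomial in
  \<open>cnj t\<close>. Its constant term, the real number \<open>s(0)\<close>, belongs to the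
  analytic side.\<close>

lemma Re_poly_eq_trig_poly:
  assumes "Im (poly s 0) = 0"
  obtains r where "\<And>t. of_real (Re (poly s t)) = trig_poly (smult (1/2) (s + [:poly s 0:])) r t"
proof -
  obtain s' where s': "\<And>t. cnj (poly s (cnj t)) = poly s' t" using cnj_poly_cnj by blast
  obtain r where r: "s' = pCons (poly s' 0) r" by (cases s') auto
  have 0: "poly s' 0 = poly s 0" using s'[of 0] assms by (auto simp: complex_eq_iff)
  have "cnj (poly s t) = poly s' (cnj t)" for t using s'[of "cnj t"] by simp
  also have "poly s' (cnj t) = poly s 0 + cnj t * poly r (cnj t)" for t
    by (subst r) (simp add: 0)
  finally have c: "cnj (poly s t) = poly s 0 + cnj t * poly r (cnj t)" for t .
  have h: "complex_of_real (Re (poly s t)) = (poly s t + cnj (poly s t)) / 2" for t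
    by (simp add: complex_eq_iff)
  show ?thesis
    by (rule that[of "smult (1/2) r"], unfold h c) (simp add: trig_poly_def field_simps)
qed

text \<open>Pythagoras: the cross term is the mean of \<open>q h\<close>, where \<open>cnj h\<close>
  is the antianalytic part. Since \<open>h\<close> is a polynomial vanishing at 0, this mean is
  0.\<close>

lemma L2_poly_le_trig_poly:
  "(LINT t|circle. (norm (poly q t))\<^sup>2) \<le> (LINT t|circle. (norm (trig_poly q r t))\<^sup>2)"
proof -
  obtain r' where r': "\<And>t. cnj (poly r (cnj t)) = poly r' t" using cnj_poly_cnj by blast
  define h where "h = (\<lambda>t. t * poly r' t)"
  define w where "w = (\<lambda>t. poly q t * h t)"
  have cont: "continuous_on S h" "continuous_on S w" for S
    unfolding h_def w_def by (intro continuous_intros)+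
  have hol: "w holomorphic_on ball 0 1"
    unfolding h_def w_def by (intro holomorphic_intros)
  have mv: "(LINT t|circle. w t) = 0"
    using mean_value_circle[OF cont(2) hol] by (simp add: w_def h_def)
  have eq: "(norm (trig_poly q r t))\<^sup>2 = (norm (poly q t))\<^sup>2 + (norm (h t))\<^sup>2 + 2 * Re (w t)" for t
  proof -
    have "trig_poly q r t = poly q t + cnj (h t)"
      by (simp add: trig_poly_def h_def flip: r')
    moreover have "(norm (a + cnj b))\<^sup>2 = (norm a)\<^sup>2 + (norm b)\<^sup>2 + 2 * Re (a * b)" for a b
      unfolding cmod_power2 by (simp add: power2_eq_square algebra_simps)
    ultimately show ?thesis by (simp only: w_def)
  qed
  have "integrable circle (\<lambda>t. (norm (poly q t))\<^sup>2)" "integrable circle (\<lambda>t. (norm (h t))\<^sup>2)" "integrable circle w"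
    by (intro continuous_integrable_circle continuous_intros cont)+
  then have "(LINT t|circle. (norm (trig_poly q r t))\<^sup>2)
      = (LINT t|circle. (norm (poly q t))\<^sup>2) + (LINT t|circle. (norm (h t))\<^sup>2) + 2 * Re (LINT t|circle. w t)"
    unfolding eq by (simp add: integrable_Re)
  also have "\<dots> \<ge> (LINT t|circle. (norm (poly q t))\<^sup>2)"
    unfolding mv by simp
  finally show ?thesis .
qed

text \<open>A nonnegative function is replaced by \<open>Re s\<close> for a polynomial
  \<open>s\<close>, to which \<open>poly_Re_pos_bound\<close> applies. The bound concerns the
  analytic part of the approximant, because the function itself has no analytic part yet.\<close>

lemma continuous_approx_analytic_part:
  fixes p :: real
  assumes p: "1 < p" "p \<le> 2"
  obtains K where "0 \<le> K"
    "\<And>\<phi> e. \<lbrakk>continuous_on (sphere 0 1) \<phi>; \<And>t. 0 \<le> \<phi> t; 0 < e\<rbrakk> \<Longrightarrow>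
      \<exists>q r. (\<forall>t\<in>sphere 0 1. norm (of_real (\<phi> t) - trig_poly q r t) \<le> e) \<and>
        Lp_pow p (poly q) \<le> K * (LINT t|circle. (\<phi> t + e) powr p)"
proof -
  obtain A where A: "0 \<le> A"
    "\<And>s. \<lbrakk>Im (poly s 0) = 0; \<And>t. t \<in> sphere 0 1 \<Longrightarrow> 0 < Re (poly s t)\<rbrakk> \<Longrightarrow>
       Lp_pow p (poly s) + norm (poly s 0) powr p \<le> A * (LINT t|circle. Re (poly s t) powr p)"
    using poly_Re_pos_bound[OF p] by metis
  show ?thesis
  proof (rule that[OF A(1)])
    fix \<phi> :: "complex \<Rightarrow> real" and e :: real
    assume c: "continuous_on (sphere 0 1) \<phi>" and nn: "\<And>t. 0 \<le> \<phi> t" and e: "0 < e"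
    \<comment> \<open>Aiming at \<open>\<phi> + e / 2\<close> with error below \<open>e / 2\<close>
      makes \<open>Re s\<close> strictly positive while keeping it below
      \<open>\<phi> + e\<close>.\<close>
    obtain s where s: "Im (poly s 0) = 0"
      "\<And>t. t \<in> sphere 0 1 \<Longrightarrow> \<bar>\<phi> t + e / 2 - Re (poly s t)\<bar> < e / 2"
      using continuous_approx_Re_poly[OF continuous_on_add[OF c continuous_on_const] half_gt_zero[OF e]]
      by metis
    have pos: "0 < Re (poly s t)" and le: "Re (poly s t) \<le> \<phi> t + e"
      and close: "\<bar>\<phi> t - Re (poly s t)\<bar> \<le> e" if "t \<in> sphere 0 1" for t
      using s(2)[OF that] nn[of t] e by (auto simp: abs_real_def split: if_splits)
    define q where "q = smult (1/2) (s + [:poly s 0:])"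
    obtain r where r: "\<And>t. of_real (Re (poly s t)) = trig_poly q r t"
      using Re_poly_eq_trig_poly[OF s(1)] unfolding q_def by metis
    have "norm (of_real (\<phi> t) - trig_poly q r t) \<le> e" if "t \<in> sphere 0 1" for t
      using close[OF that] by (simp flip: r of_real_diff)
    moreover have "Lp_pow p (poly q) \<le> A * (LINT t|circle. (\<phi> t + e) powr p)"
    proof -
      have p0: "0 \<le> p" using p by simp
      have "Lp_pow p (poly q) = Lp_pow p (\<lambda>t. (1/2) * (poly s t + poly s 0))"
        by (simp add: q_def Lp_pow_def)
      also have "\<dots> = (1/2) powr p * Lp_pow p (\<lambda>t. poly s t + poly s 0)"
        using p0 by (subst Lp_scale) (auto intro!: Lp_continuous continuous_intros)
      also have "\<dots> \<le> (1/2) powr p * (2 powr p * (Lp_pow p (poly s) + Lp_pow p (\<lambda>t. poly s 0)))"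
        by (intro mult_left_mono Lp_add p0 Lp_continuous continuous_intros) auto
      also have "\<dots> = Lp_pow p (poly s) + norm (poly s 0) powr p"
        by (simp add: Lp_pow_def powr_divide)
      also have "\<dots> \<le> A * (LINT t|circle. Re (poly s t) powr p)"
        by (rule A(2)[OF s(1) pos])
      also have "\<dots> \<le> A * (LINT t|circle. (\<phi> t + e) powr p)"
      proof (intro mult_left_mono A(1) integral_mono_AE AE_I2)
        have "\<phi> t + e \<noteq> 0" for t using nn[of t] e by linarith
        then show "integrable circle (\<lambda>t. (\<phi> t + e) powr p)"
          by (intro continuous_integrable_circle continuous_intros c) auto
        show "integrable circle (\<lambda>t. Re (poly s t) powr p)"
          by (intro continuous_integrable_circle continuous_intros) (use pos in force)
        fix t assume "t \<in> space circle"
        then show "Re (poly s t) powr p \<le> (\<phi> t + e) powr p"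
          using pos[of t] le[of t] p by (intro powr_mono2) auto
      qed
      finally show ?thesis .
    qed
    ultimately show "\<exists>q r. (\<forall>t\<in>sphere 0 1. norm (of_real (\<phi> t) - trig_poly q r t) \<le> e) \<and>
        Lp_pow p (poly q) \<le> A * (LINT t|circle. (\<phi> t + e) powr p)"
      by blast
  qed
qed

text \<open>The positive and negative parts of \<open>Re f\<close> and \<open>Im f\<close> are
  treated separately. Each is dominated by \<open>|f|\<close>, so all four share one bound, and the
  four errors add up to \<open>4 * e\<close>.\<close>

lemma continuous_approx_analytic_part_complex:
  fixes p :: real
  assumes p: "1 < p" "p \<le> 2"
  obtains K where "0 \<le> K"
    "\<And>f e. \<lbrakk>continuous_on (sphere 0 1) f; 0 < e\<rbrakk> \<Longrightarrow>
      \<exists>q r. (\<forall>t\<in>sphere 0 1. norm (f t - trig_poly q r t) \<le> 4 * e) \<and>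
        Lp_pow p (poly q) \<le> K * (LINT t|circle. (norm (f t) + e) powr p)"
proof -
  have p0: "0 \<le> p" using p by simp
  obtain K where K: "0 \<le> K"
    "\<And>\<phi> e. \<lbrakk>continuous_on (sphere 0 1) \<phi>; \<And>t. 0 \<le> \<phi> t; 0 < e\<rbrakk> \<Longrightarrow>
      \<exists>q r. (\<forall>t\<in>sphere 0 1. norm (of_real (\<phi> t) - trig_poly q r t) \<le> e) \<and>
        Lp_pow p (poly q) \<le> K * (LINT t|circle. (\<phi> t + e) powr p)"
    using continuous_approx_analytic_part[OF p] by metis
  show ?thesis
  proof (rule that[of "2 powr p * (2 powr p * (4 * K))"])
    show "0 \<le> 2 powr p * (2 powr p * (4 * K))" using K(1) by simp
    fix f :: "complex \<Rightarrow> complex" and e :: real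
    assume f: "continuous_on (sphere 0 1) f" and e: "0 < e"
    define I where "I = (LINT t|circle. (norm (f t) + e) powr p)"
    have part: "\<exists>q r. (\<forall>t\<in>sphere 0 1. norm (of_real (\<phi> t) - trig_poly q r t) \<le> e) \<and>
        Lp_pow p (poly q) \<le> K * I"
      if c: "continuous_on (sphere 0 1) \<phi>" and nn: "\<And>t. 0 \<le> \<phi> t" and le: "\<And>t. \<phi> t \<le> norm (f t)" for \<phi>
    proof -
      have "(LINT t|circle. (\<phi> t + e) powr p) \<le> I"
        unfolding I_def
      proof (intro integral_mono_AE AE_I2)
        have "norm (f t) + e \<noteq> 0" "\<phi> t + e \<noteq> 0" for t
          using nn[of t] e by (auto simp: add_nonneg_eq_0_iff)
        then show "integrable circle (\<lambda>t. (\<phi> t + e) powr p)" "integrable circle (\<lambda>t. (norm (f t) + e) powr p)"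
          by (intro continuous_integrable_circle continuous_intros c f; simp)+
        show "(\<phi> t + e) powr p \<le> (norm (f t) + e) powr p" for t
          using nn[of t] le[of t] e p by (intro powr_mono2) auto
      qed
      then have "K * (LINT t|circle. (\<phi> t + e) powr p) \<le> K * I" by (intro mult_left_mono K(1))
      then show ?thesis using K(2)[OF c nn e] by (meson order_trans)
    qed
    have "\<exists>q r. (\<forall>t\<in>sphere 0 1. norm (of_real (max 0 (Re (f t))) - trig_poly q r t) \<le> e) \<and> Lp_pow p (poly q) \<le> K * I"
      by (rule part) (auto intro!: continuous_intros f abs_Re_le_cmod[THEN abs_le_D1])
    then obtain q1 r1 where 1: "\<And>t. t\<in>sphere 0 1 \<Longrightarrow> norm (of_real (max 0 (Re (f t))) - trig_poly q1 r1 t) \<le> e"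
      "Lp_pow p (poly q1) \<le> K * I" by blast
    have "\<exists>q r. (\<forall>t\<in>sphere 0 1. norm (of_real (max 0 (- Re (f t))) - trig_poly q r t) \<le> e) \<and> Lp_pow p (poly q) \<le> K * I"
      by (rule part) (auto intro!: continuous_intros f abs_Re_le_cmod[THEN abs_le_D2])
    then obtain q2 r2 where 2: "\<And>t. t\<in>sphere 0 1 \<Longrightarrow> norm (of_real (max 0 (- Re (f t))) - trig_poly q2 r2 t) \<le> e"
      "Lp_pow p (poly q2) \<le> K * I" by blast
    have "\<exists>q r. (\<forall>t\<in>sphere 0 1. norm (of_real (max 0 (Im (f t))) - trig_poly q r t) \<le> e) \<and> Lp_pow p (poly q) \<le> K * I"
      by (rule part) (auto intro!: continuous_intros f abs_Im_le_cmod[THEN abs_le_D1])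
    then obtain q3 r3 where 3: "\<And>t. t\<in>sphere 0 1 \<Longrightarrow> norm (of_real (max 0 (Im (f t))) - trig_poly q3 r3 t) \<le> e"
      "Lp_pow p (poly q3) \<le> K * I" by blast
    have "\<exists>q r. (\<forall>t\<in>sphere 0 1. norm (of_real (max 0 (- Im (f t))) - trig_poly q r t) \<le> e) \<and> Lp_pow p (poly q) \<le> K * I"
      by (rule part) (auto intro!: continuous_intros f abs_Im_le_cmod[THEN abs_le_D2])
    then obtain q4 r4 where 4: "\<And>t. t\<in>sphere 0 1 \<Longrightarrow> norm (of_real (max 0 (- Im (f t))) - trig_poly q4 r4 t) \<le> e"
      "Lp_pow p (poly q4) \<le> K * I" by blast
    define q where "q = (q1 - q2) + smult \<i> (q3 - q4)"
    define r where "r = (r1 - r2) + smult \<i> (r3 - r4)"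
    have "norm (f t - trig_poly q r t) \<le> 4 * e" if t: "t \<in> sphere 0 1" for t
    proof -
      let ?d1 = "of_real (max 0 (Re (f t))) - trig_poly q1 r1 t"
      let ?d2 = "of_real (max 0 (- Re (f t))) - trig_poly q2 r2 t"
      let ?d3 = "of_real (max 0 (Im (f t))) - trig_poly q3 r3 t"
      let ?d4 = "of_real (max 0 (- Im (f t))) - trig_poly q4 r4 t"
      have f: "f t = (of_real (max 0 (Re (f t))) - of_real (max 0 (- Re (f t)))) +
          \<i> * (of_real (max 0 (Im (f t))) - of_real (max 0 (- Im (f t))))"
        by (auto simp: complex_eq_iff max_def)
      have tr: "trig_poly q r t = (trig_poly q1 r1 t - trig_poly q2 r2 t) + \<i> * (trig_poly q3 r3 t - trig_poly q4 r4 t)"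
        by (simp add: q_def r_def trig_poly_def algebra_simps)
      have "f t - trig_poly q r t = (?d1 - ?d2) + \<i> * (?d3 - ?d4)"
        by (subst f, subst tr) (simp only: algebra_simps)
      also have "norm \<dots> \<le> norm (?d1 - ?d2) + norm (\<i> * (?d3 - ?d4))" by (rule norm_triangle_ineq)
      also have "\<dots> \<le> (norm ?d1 + norm ?d2) + (norm ?d3 + norm ?d4)"
        unfolding norm_mult norm_ii mult_1_left by (intro add_mono norm_triangle_ineq4)
      also have "\<dots> \<le> 4 * e"
        using 1(1)[OF t] 2(1)[OF t] 3(1)[OF t] 4(1)[OF t] by linarith
      finally show ?thesis .
    qed
    moreover have "Lp_pow p (poly q) \<le> 2 powr p * (2 powr p * (4 * K)) * I"
    proof -
      have L: "Lp_pow p (\<lambda>t. poly u t - poly v t) \<le> 2 powr p * (2 * (K * I))"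
        if "Lp_pow p (poly u) \<le> K * I" "Lp_pow p (poly v) \<le> K * I" for u v
        by (rule order_trans[OF Lp_diff(2)[OF p0 Lp_poly[OF p0] Lp_poly[OF p0]]])
           (use that in simp)
      have "Lp_pow p (poly q) = Lp_pow p (\<lambda>t. (poly q1 t - poly q2 t) + \<i> * (poly q3 t - poly q4 t))"
        by (simp add: q_def Lp_pow_def)
      also have "\<dots> \<le> 2 powr p * (Lp_pow p (\<lambda>t. poly q1 t - poly q2 t) + Lp_pow p (\<lambda>t. \<i> * (poly q3 t - poly q4 t)))"
        by (intro Lp_add p0 Lp_continuous continuous_intros)
      also have "Lp_pow p (\<lambda>t. \<i> * (poly q3 t - poly q4 t)) = Lp_pow p (\<lambda>t. poly q3 t - poly q4 t)"
        by (simp add: Lp_pow_def norm_mult)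
      also have "2 powr p * (Lp_pow p (\<lambda>t. poly q1 t - poly q2 t) + Lp_pow p (\<lambda>t. poly q3 t - poly q4 t))
          \<le> 2 powr p * (2 powr p * (2 * (K * I)) + 2 powr p * (2 * (K * I)))"
        by (intro mult_left_mono add_mono L 1 2 3 4) auto
      finally show ?thesis by (simp add: algebra_simps)
    qed
    ultimately show "\<exists>q r. (\<forall>t\<in>sphere 0 1. norm (f t - trig_poly q r t) \<le> 4 * e) \<and>
        Lp_pow p (poly q) \<le> 2 powr p * (2 powr p * (4 * K)) * (LINT t|circle. (norm (f t) + e) powr p)"
      unfolding I_def by blast
  qed
qed

section \<open>Boundedness of the projection on trigonometric polynomials\<close>

definition riesz_bounded :: "real \<Rightarrow> bool" where
  "riesz_bounded p \<longleftrightarrow> (\<exists>C\<ge>0. \<forall>q r. Lp_pow p (poly q) \<le> C * Lp_pow p (trig_poly q r))"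

lemma powr_le_square:
  fixes x :: real
  assumes "0 \<le> p" "p \<le> 2" "0 < e" "0 \<le> x"
  shows "x powr p \<le> e powr p * (1 + x\<^sup>2 / e\<^sup>2)"
proof -
  have "(x / e) powr p \<le> 1 + (x / e)\<^sup>2"
  proof (cases "x / e \<le> 1")
    case True
    then have "(x / e) powr p \<le> 1" using assms by (intro powr_le1) auto
    then show ?thesis using zero_le_power2[of "x / e"] by linarith
  next
    case False
    then have "(x / e) powr p \<le> (x / e) powr 2" using assms by (intro powr_mono) auto
    then show ?thesis using False by simp
  qed
  then have "e powr p * (x / e) powr p \<le> e powr p * (1 + (x / e)\<^sup>2)"
    by (intro mult_left_mono) auto
  then show ?thesis using assms by (simp add: powr_divide power_divide)
qed

text \<open>The previous estimate controls the analytic part \<open>u\<close> of an approximant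
  rather than \<open>q\<close> itself. But \<open>q - u\<close> is the analytic part of a uniformly
  small trigonometric polynomial, hence small in \<open>L^2\<close> by orthogonality and, since
  \<open>p \<le> 2\<close>, also in \<open>L^p\<close>. The error is a multiple of
  \<open>e powr p\<close>, and \<open>e\<close> is arbitrary.\<close>

lemma riesz_bounded_le_2:
  assumes p: "1 < p" "p \<le> 2"
  shows "riesz_bounded p"
proof -
  have p0: "0 \<le> p" using p by simp
  obtain K where K: "0 \<le> K"
    "\<And>f e. \<lbrakk>continuous_on (sphere 0 1) f; 0 < e\<rbrakk> \<Longrightarrow>
      \<exists>q r. (\<forall>t\<in>sphere 0 1. norm (f t - trig_poly q r t) \<le> 4 * e) \<and>
        Lp_pow p (poly q) \<le> K * (LINT t|circle. (norm (f t) + e) powr p)"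
    using continuous_approx_analytic_part_complex[OF p] by metis
  define C where "C = 2 powr p * (K * 2 powr p)"
  define D where "D = C + 2 powr p * 17"
  have CD: "0 \<le> C" "0 < D" using K(1) by (auto simp: C_def D_def add_nonneg_pos)
  have "Lp_pow p (poly q) \<le> C * Lp_pow p (trig_poly q r)" for q r
  proof -
    let ?f = "trig_poly q r"
    have "Lp_pow p (poly q) \<le> C * Lp_pow p ?f + D * e powr p" if e: "0 < e" for e
    proof -
      obtain u v where uv: "\<And>t. t\<in>sphere 0 1 \<Longrightarrow> norm (?f t - trig_poly u v t) \<le> 4 * e"
        "Lp_pow p (poly u) \<le> K * (LINT t|circle. (norm (?f t) + e) powr p)"
        using K(2)[OF continuous_trig_poly e] by blast
      have i2: "integrable circle (\<lambda>t. (norm (poly (q - u) t))\<^sup>2)"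
        by (intro continuous_integrable_circle continuous_intros)
      have "(LINT t|circle. (norm (poly (q - u) t))\<^sup>2) \<le> (LINT t|circle. (norm (trig_poly (q - u) (r - v) t))\<^sup>2)"
        by (rule L2_poly_le_trig_poly)
      also have "\<dots> \<le> (LINT t|circle. (4 * e)\<^sup>2)"
      proof (intro integral_mono_AE AE_I2)
        show "integrable circle (\<lambda>t. (norm (trig_poly (q - u) (r - v) t))\<^sup>2)"
          by (intro continuous_integrable_circle continuous_intros continuous_trig_poly)
        fix t assume "t \<in> space circle"
        then show "(norm (trig_poly (q - u) (r - v) t))\<^sup>2 \<le> (4 * e)\<^sup>2"
          using uv(1)[of t] by (intro power_mono) (auto simp flip: trig_poly_diff)
      qed simp
      finally have L2: "(LINT t|circle. (norm (poly (q - u) t))\<^sup>2) \<le> 16 * e\<^sup>2" by (simp add: power_mult_distrib)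
      have "Lp_pow p (poly (q - u)) \<le> (LINT t|circle. e powr p * (1 + (norm (poly (q - u) t))\<^sup>2 / e\<^sup>2))"
        using p i2 e by (intro Lp_pow_mono Lp_poly AE_I2 powr_le_square) auto
      also have "\<dots> = e powr p * (1 + (LINT t|circle. (norm (poly (q - u) t))\<^sup>2) / e\<^sup>2)"
        using i2 by simp
      also have "\<dots> \<le> e powr p * (1 + 16 * e\<^sup>2 / e\<^sup>2)"
        by (intro mult_left_mono add_left_mono divide_right_mono L2) auto
      finally have d: "Lp_pow p (poly (q - u)) \<le> 17 * e powr p" using e by simp
      \<comment> \<open>The integrand is read as the p-th power of a nonnegative complex-valued
        function, so that \<open>Lp_add\<close> can separate the two summands.\<close>
      have "(LINT t|circle. (norm (?f t) + e) powr p) = Lp_pow p (\<lambda>t. of_real (norm (?f t)) + of_real e)"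
        unfolding Lp_pow_def
        using e by (intro Bochner_Integration.integral_cong) (auto simp del: of_real_add simp flip: of_real_add)
      also have "\<dots> \<le> 2 powr p * (Lp_pow p (\<lambda>t. of_real (norm (?f t))) + Lp_pow p (\<lambda>t. of_real e))"
        by (intro Lp_add p0 Lp_continuous continuous_intros continuous_trig_poly)
      also have "\<dots> = 2 powr p * (Lp_pow p ?f + e powr p)"
        using e by (simp add: Lp_pow_def)
      finally have "K * (LINT t|circle. (norm (?f t) + e) powr p) \<le> K * (2 powr p * (Lp_pow p ?f + e powr p))"
        by (intro mult_left_mono K(1))
      with uv(2) have u: "Lp_pow p (poly u) \<le> K * (2 powr p * (Lp_pow p ?f + e powr p))" by linarith
      have "Lp_pow p (poly q) = Lp_pow p (\<lambda>t. poly u t + poly (q - u) t)" by simp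
      also have "\<dots> \<le> 2 powr p * (Lp_pow p (poly u) + Lp_pow p (poly (q - u)))"
        by (intro Lp_add p0 Lp_poly)
      also have "\<dots> \<le> 2 powr p * (K * (2 powr p * (Lp_pow p ?f + e powr p)) + 17 * e powr p)"
        by (intro mult_left_mono add_mono u d) auto
      also have "\<dots> = C * Lp_pow p ?f + D * e powr p"
        by (simp add: C_def D_def algebra_simps)
      finally show ?thesis .
    qed
    note * = this
    show ?thesis
    proof (rule field_le_epsilon)
      fix d :: real assume "0 < d"
      then have "0 < d / D" using CD by simp
      \<comment> \<open>This choice of \<open>e\<close> turns the error \<open>D * e powr p\<close>
        into exactly \<open>d\<close>.\<close>
      with *[of "(d / D) powr (1 / p)"] \<open>0 < d\<close> CD p
      show "Lp_pow p (poly q) \<le> C * Lp_pow p ?f + d"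
        by (simp add: powr_powr)
    qed
  qed
  then show ?thesis unfolding riesz_bounded_def using CD by blast
qed

text \<open>Cotlar's trick: if \<open>f = g + h\<close> with \<open>g\<close> analytic and \<open>h\<close> antianalytic, then
  \<open>f (2 g - f) = g\<^sup>2 - h\<^sup>2\<close> splits into the analytic \<open>g\<^sup>2\<close> and the antianalytic \<open>-h\<^sup>2\<close>.\<close>

lemma riesz_bounded_double:
  assumes p: "0 < p" and "riesz_bounded p"
  shows "riesz_bounded (2 * p)"
proof -
  have p0: "0 \<le> p" "0 \<le> 2 * p" using p by auto
  obtain C where C: "0 \<le> C" "\<And>q r. Lp_pow p (poly q) \<le> C * Lp_pow p (trig_poly q r)"
    using assms(2) unfolding riesz_bounded_def by blast
  define k where "k = (2::real) powr p"
  have k: "0 < k" by (simp add: k_def)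
  \<comment> \<open>The weight of the arithmetic-geometric mean inequality below. It is so small
    that the term in \<open>X\<close> on the right gets a coefficient at most 1/2 and can be
    absorbed on the left; absorption doubles the coefficient of \<open>Y\<close>, whence the factor
    2 in \<open>D\<close>.\<close>
  define \<delta> where "\<delta> = 1 / (2 * (C * k * k + 1))"
  have Ckk: "0 \<le> C * k * k" using C(1) k by simp
  have \<delta>: "0 < \<delta>" "C * k * k * \<delta> \<le> 1 / 2"
    using Ckk by (auto simp: \<delta>_def field_simps)
  define D where "D = 2 * (C * k * (k * (1 / \<delta>) + 1))"
  have "Lp_pow (2 * p) (poly q) \<le> D * Lp_pow (2 * p) (trig_poly q r)" for q r
  proof -
    let ?f = "trig_poly q r" and ?g = "poly q"
    let ?h = "\<lambda>t. cnj t * poly r (cnj t)"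
    define X where "X = Lp_pow (2 * p) ?g"
    define Y where "Y = Lp_pow (2 * p) ?f"
    have sq: "norm (z\<^sup>2) powr p = norm z powr (2 * p)" for z :: complex
      by (simp add: norm_power powr_powr flip: powr_numeral)
    \<comment> \<open>\<open>pCons\<close> supplies one factor \<open>cnj t\<close>:
      \<open>trig_poly\<close> itself provides only one, whereas the square of the antianalytic part
      carries two.\<close>
    have tr: "trig_poly (q\<^sup>2) (pCons 0 (- r\<^sup>2)) t = ?f t * (2 * ?g t - ?f t)" for t
      by (simp add: trig_poly_def algebra_simps power2_eq_square)
    have pt: "norm (?f t * (2 * ?g t - ?f t)) powr p \<le>
        k * (k * (\<delta> * norm (?g t) powr (2 * p) + (1 / \<delta>) * norm (?f t) powr (2 * p)) + norm (?f t) powr (2 * p))"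
      for t
    proof -
      have am: "x * y \<le> \<delta> * x\<^sup>2 + (1 / \<delta>) * y\<^sup>2" if "0 \<le> x" "0 \<le> y" for x y :: real
      proof -
        have "0 \<le> (\<delta> * x - y)\<^sup>2" by simp
        then have "2 * (\<delta> * x * y) \<le> (\<delta> * x)\<^sup>2 + y\<^sup>2" by (simp add: power2_eq_square algebra_simps)
        moreover have "0 \<le> \<delta> * x * y" using \<delta> that by simp
        ultimately have "\<delta> * x * y \<le> (\<delta> * x)\<^sup>2 + y\<^sup>2" by linarith
        then show ?thesis using \<delta>(1) by (simp add: field_simps power2_eq_square)
      qed
      have "norm (?f t * (2 * ?g t - ?f t)) powr p = norm (2 * (?f t * ?g t) + - (?f t)\<^sup>2) powr p"
        by (simp add: algebra_simps power2_eq_square)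
      also have "\<dots> \<le> k * (norm (2 * (?f t * ?g t)) powr p + norm (- (?f t)\<^sup>2) powr p)"
        unfolding k_def by (rule norm_add_powr_le[OF p0(1)])
      also have "norm (- (?f t)\<^sup>2) powr p = norm (?f t) powr (2 * p)"
        by (simp add: sq)
      also have "norm (2 * (?f t * ?g t)) powr p = k * (norm (?g t) powr p * norm (?f t) powr p)"
        by (simp add: norm_mult powr_mult k_def)
      also have "norm (?g t) powr p * norm (?f t) powr p \<le>
          \<delta> * (norm (?g t) powr p)\<^sup>2 + (1 / \<delta>) * (norm (?f t) powr p)\<^sup>2"
        by (rule am) auto
      finally show ?thesis
        using k by (simp add: power2_eq_square flip: powr_add)
    qed
    have i: "integrable circle (\<lambda>t. norm (?g t) powr (2 * p))" "integrable circle (\<lambda>t. norm (?f t) powr (2 * p))"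
      using Lp_integrable_powr[OF Lp_poly[OF p0(2)]] Lp_integrable_powr[OF Lp_trig_poly[OF p0(2)]] by auto
    have "X = Lp_pow p (poly (q\<^sup>2))"
      unfolding X_def Lp_pow_def by (simp add: sq)
    also have "\<dots> \<le> C * Lp_pow p (trig_poly (q\<^sup>2) (pCons 0 (- r\<^sup>2)))" by (rule C(2))
    also have "Lp_pow p (trig_poly (q\<^sup>2) (pCons 0 (- r\<^sup>2))) \<le>
       (LINT t|circle. k * (k * (\<delta> * norm (?g t) powr (2 * p) + (1 / \<delta>) * norm (?f t) powr (2 * p)) + norm (?f t) powr (2 * p)))"
      using i pt by (intro Lp_pow_mono Lp_trig_poly p0 AE_I2) (auto simp: tr)
    also have "\<dots> = k * (k * (\<delta> * X + (1 / \<delta>) * Y) + Y)"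
      using i by (simp add: X_def Y_def Lp_pow_def)
    finally have "X \<le> C * (k * (k * (\<delta> * X + (1 / \<delta>) * Y) + Y))" using C(1) by (simp add: mult_left_mono)
    also have "\<dots> = (C * k * k * \<delta>) * X + C * k * (k * (1 / \<delta>) + 1) * Y"
      by (simp add: algebra_simps)
    also have "\<dots> \<le> (1 / 2) * X + C * k * (k * (1 / \<delta>) + 1) * Y"
      using \<delta>(2) Lp_pow_nonneg[of "2 * p" ?g] by (intro add_right_mono mult_right_mono) (auto simp: X_def)
    finally show ?thesis by (simp add: X_def Y_def D_def)
  qed
  moreover have "0 \<le> D" using C(1) k \<delta> by (auto simp: D_def)
  ultimately show ?thesis unfolding riesz_bounded_def by blast
qed

text \<open>Halving an exponent above 2 keeps it above 1, so finitely many halvings lead into the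
  range from 1 to 2; Cotlar's step then doubles back.\<close>

theorem M_Riesz:
  assumes "1 < p" shows "riesz_bounded p"
proof -
  have "\<lbrakk>1 < p; p \<le> 2 * 2 ^ n\<rbrakk> \<Longrightarrow> riesz_bounded p" for n p
  proof (induction n arbitrary: p)
    case (Suc n)
    show ?case
    proof (cases "p \<le> 2")
      case False
      then have "riesz_bounded (p / 2)" using Suc.prems by (intro Suc.IH) auto
      then show ?thesis using riesz_bounded_double[of "p / 2"] False by simp
    qed (use Suc.prems in \<open>auto intro: riesz_bounded_le_2\<close>)
  qed (auto intro: riesz_bounded_le_2)
  moreover obtain n where "p / 2 < 2 ^ n" using real_arch_pow[of 2 "p / 2"] by auto
  ultimately show ?thesis using assms by (metis less_divide_eq_numeral1(1) less_imp_le mult.commute field_sum_of_halves pos_divide_less_eq zero_less_numeral)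
qed

section \<open>Density of trigonometric polynomials and the Riesz projection\<close>

definition trig_approximable :: "real \<Rightarrow> (complex \<Rightarrow> complex) \<Rightarrow> bool" where
  "trig_approximable p f \<longleftrightarrow>
     f \<in> Lp p \<and> (\<forall>e>0. \<exists>q r. Lp_pow p (\<lambda>t. f t - trig_poly q r t) < e)"

lemma trig_approximable_continuous:
  assumes p: "0 < p" and f: "continuous_on (sphere 0 1) f"
  shows "trig_approximable p f"
  unfolding trig_approximable_def
proof (intro conjI allI impI)
  show "f \<in> Lp p" using p f by (intro Lp_continuous) auto
  fix e :: real assume e: "0 < e"
  define d where "d = (e / 2) powr (1 / p) / 4"
  have d: "0 < d" "(4 * d) powr p = e / 2" using e p by (auto simp: d_def powr_powr)
  \<comment> \<open>Only the uniform approximation is wanted here, so the exponent 2 is an arbitrary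
    admissible choice and the norm bound is dropped.\<close>
  obtain q r where qr: "\<And>t. t\<in>sphere 0 1 \<Longrightarrow> norm (f t - trig_poly q r t) \<le> 4 * d"
    using continuous_approx_analytic_part_complex[of 2] f d(1)
    by (metis one_less_numeral_iff order_refl semiring_norm(76))
  have "Lp_pow p (\<lambda>t. f t - trig_poly q r t) \<le> (LINT t|circle. (4 * d) powr p)"
    using p qr
    by (intro Lp_pow_mono Lp_continuous continuous_intros f continuous_trig_poly AE_I2 powr_mono2) auto
  then show "\<exists>q r. Lp_pow p (\<lambda>t. f t - trig_poly q r t) < e"
    using d e by (intro exI[of _ q] exI[of _ r]) simp
qed

lemma trig_approximable_limit:
  assumes p: "0 \<le> p" and f: "f \<in> Lp p"
    and "\<And>e. 0 < e \<Longrightarrow> \<exists>g. trig_approximable p g \<and> Lp_pow p (\<lambda>t. f t - g t) < e"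
  shows "trig_approximable p f"
  unfolding trig_approximable_def
proof (intro conjI allI impI f)
  fix e :: real assume e: "0 < e"
  define d where "d = e / (2 * 2 powr p)"
  have d: "0 < d" using e by (simp add: d_def)
  obtain g where g: "trig_approximable p g" "Lp_pow p (\<lambda>t. f t - g t) < d"
    using assms(3)[OF d] by blast
  obtain q r where qr: "Lp_pow p (\<lambda>t. g t - trig_poly q r t) < d" "g \<in> Lp p"
    using g(1) d unfolding trig_approximable_def by blast
  have "Lp_pow p (\<lambda>t. f t - trig_poly q r t) \<le>
      2 powr p * (Lp_pow p (\<lambda>t. f t - g t) + Lp_pow p (\<lambda>t. g t - trig_poly q r t))"
    by (rule Lp_pow_triangle[OF p f qr(2) Lp_trig_poly[OF p]])
  also have "\<dots> < 2 powr p * (d + d)"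
    using g(2) qr(1) by (intro mult_strict_left_mono add_strict_mono) auto
  also have "\<dots> = e" by (simp add: d_def)
  finally show "\<exists>q r. Lp_pow p (\<lambda>t. f t - trig_poly q r t) < e" by blast
qed

lemma trig_approximable_add:
  assumes p: "0 \<le> p" and f: "trig_approximable p f" and g: "trig_approximable p g"
  shows "trig_approximable p (\<lambda>t. f t + g t)"
  unfolding trig_approximable_def
proof (intro conjI allI impI)
  have fg: "f \<in> Lp p" "g \<in> Lp p" using f g by (auto simp: trig_approximable_def)
  show "(\<lambda>t. f t + g t) \<in> Lp p" by (rule Lp_add[OF p fg])
  fix e :: real assume e: "0 < e"
  define d where "d = e / (2 * 2 powr p)"
  have d: "0 < d" using e by (simp add: d_def)
  obtain q r where qr: "Lp_pow p (\<lambda>t. f t - trig_poly q r t) < d"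
    using f d unfolding trig_approximable_def by blast
  obtain q' r' where qr': "Lp_pow p (\<lambda>t. g t - trig_poly q' r' t) < d"
    using g d unfolding trig_approximable_def by blast
  have "Lp_pow p (\<lambda>t. (f t + g t) - trig_poly (q + q') (r + r') t) =
      Lp_pow p (\<lambda>t. (f t - trig_poly q r t) + (g t - trig_poly q' r' t))"
    by (simp add: algebra_simps flip: trig_poly_add)
  also have "\<dots> \<le> 2 powr p * (Lp_pow p (\<lambda>t. f t - trig_poly q r t) + Lp_pow p (\<lambda>t. g t - trig_poly q' r' t))"
    by (intro Lp_add Lp_diff Lp_trig_poly p fg)
  also have "\<dots> < 2 powr p * (d + d)"
    using qr qr' by (intro mult_strict_left_mono add_strict_mono) auto
  also have "\<dots> = e" by (simp add: d_def)
  finally show "\<exists>q r. Lp_pow p (\<lambda>t. (f t + g t) - trig_poly q r t) < e" by blast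
qed

lemma trig_approximable_scale:
  assumes p: "0 \<le> p" and f: "trig_approximable p f"
  shows "trig_approximable p (\<lambda>t. c * f t)"
  unfolding trig_approximable_def
proof (intro conjI allI impI)
  have fp: "f \<in> Lp p" using f by (auto simp: trig_approximable_def)
  show "(\<lambda>t. c * f t) \<in> Lp p" by (rule Lp_scale[OF fp])
  fix e :: real assume e: "0 < e"
  define d where "d = e / (norm c powr p + 1)"
  have k: "0 < norm c powr p + 1" by (rule add_nonneg_pos) auto
  then have d: "0 < d" using e by (simp add: d_def)
  obtain q r where qr: "Lp_pow p (\<lambda>t. f t - trig_poly q r t) < d"
    using f d unfolding trig_approximable_def by blast
  have "Lp_pow p (\<lambda>t. c * f t - trig_poly (smult c q) (smult c r) t) =
      Lp_pow p (\<lambda>t. c * (f t - trig_poly q r t))"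
    by (simp add: algebra_simps flip: trig_poly_smult)
  also have "\<dots> = norm c powr p * Lp_pow p (\<lambda>t. f t - trig_poly q r t)"
    by (intro Lp_scale Lp_diff Lp_trig_poly p fp)
  also have "\<dots> \<le> norm c powr p * d" using qr by (intro mult_left_mono) auto
  also have "\<dots> < e" using k e by (simp add: d_def field_simps)
  finally show "\<exists>q r. Lp_pow p (\<lambda>t. c * f t - trig_poly q r t) < e" by blast
qed

text \<open>Closure under dominated pointwise limits drives the passage from continuous functions to
  indicators, simple functions and finally all of \<open>L^p\<close>.\<close>

lemma trig_approximable_dominated:
  assumes p: "0 < p" and g: "\<And>k. trig_approximable p (g k)"
    and f: "f \<in> borel_measurable circle" and w: "w \<in> Lp p"
    and lim: "\<And>t. t \<in> sphere 0 1 \<Longrightarrow> (\<lambda>k. g k t) \<longlonglongrightarrow> f t"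
    and bd: "\<And>k t. t \<in> sphere 0 1 \<Longrightarrow> norm (g k t) \<le> norm (w t)"
  shows "trig_approximable p f"
proof -
  have gk: "g k \<in> Lp p" for k using g by (simp add: trig_approximable_def)
  have fw: "norm (f t) \<le> norm (w t)" if "t \<in> sphere 0 1" for t
    using bd[OF that] by (intro tendsto_upperbound[OF tendsto_norm[OF lim[OF that]]]) auto
  have fL: "f \<in> Lp p"
    using fw p by (intro LpI_bound[OF f Lp_integrable_powr[OF w]] AE_I2) (auto intro: powr_mono2)
  have "(\<lambda>k. LINT t|circle. norm (f t - g k t) powr p) \<longlonglongrightarrow> (LINT t|circle. 0)"
  proof (rule integral_dominated_convergence[where w = "\<lambda>t. 2 powr p * norm (w t) powr p"])
    show "(\<lambda>t. norm (f t - g k t) powr p) \<in> borel_measurable circle" for k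
      using f Lp_measurable[OF gk[of k]] by measurable
    show "integrable circle (\<lambda>t. 2 powr p * norm (w t) powr p)"
      using Lp_integrable_powr[OF w] by simp
    show "AE t in circle. (\<lambda>k. norm (f t - g k t) powr p) \<longlonglongrightarrow> 0"
    proof (rule AE_I2)
      fix t assume "t \<in> space circle"
      then have "(\<lambda>k. norm (f t - g k t)) \<longlonglongrightarrow> norm (f t - f t)"
        by (intro tendsto_intros lim) auto
      then show "(\<lambda>k. norm (f t - g k t) powr p) \<longlonglongrightarrow> 0"
        using p by (auto intro: tendsto_zero_powrI)
    qed
    show "AE t in circle. norm (norm (f t - g k t) powr p) \<le> 2 powr p * norm (w t) powr p" for k
    proof (rule AE_I2)
      fix t assume t: "t \<in> space circle"
      have "norm (f t - g k t) \<le> 2 * norm (w t)"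
        using norm_triangle_ineq4[of "f t" "g k t"] bd[of t k] fw[of t] t by simp
      then have "norm (f t - g k t) powr p \<le> (2 * norm (w t)) powr p"
        using p by (intro powr_mono2) auto
      then show "norm (norm (f t - g k t) powr p) \<le> 2 powr p * norm (w t) powr p"
        by (simp add: powr_mult)
    qed
  qed simp
  then have L: "(\<lambda>k. Lp_pow p (\<lambda>t. f t - g k t)) \<longlonglongrightarrow> 0" by (simp add: Lp_pow_def)
  show ?thesis
  proof (rule trig_approximable_limit[OF _ fL])
    fix e :: real assume "0 < e"
    then have "\<forall>\<^sub>F k in sequentially. Lp_pow p (\<lambda>t. f t - g k t) < e"
      using order_tendstoD(2)[OF L] by simp
    then obtain k where "Lp_pow p (\<lambda>t. f t - g k t) < e"
      by (auto simp: eventually_sequentially)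
    then show "\<exists>g. trig_approximable p g \<and> Lp_pow p (\<lambda>t. f t - g t) < e" using g by blast
  qed (use p in simp)
qed

text \<open>A Dynkin class argument: the closed sets are stable under intersection and generate the
  Borel sets. For a closed set the indicator is the limit of the cut-off functions
  \<open>max 0 (1 - k * infdist t A)\<close>; complements and disjoint unions follow by linearity
  and domination by 1.\<close>

lemma trig_approximable_indicator:
  assumes p: "0 < p" and A: "A \<in> sets borel"
  shows "trig_approximable p (indicator A)"
proof -
  have p0: "0 \<le> p" using p by simp
  have const: "trig_approximable p (\<lambda>t. c)" for c
    by (intro trig_approximable_continuous p continuous_intros)
  have one: "(\<lambda>t. 1) \<in> Lp p" using const[of 1] by (simp add: trig_approximable_def)
  have "Int_stable (Collect (closed :: complex set \<Rightarrow> bool))"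
    by (auto simp: Int_stable_def)
  moreover have "Collect (closed :: complex set \<Rightarrow> bool) \<subseteq> Pow UNIV" by simp
  moreover have "A \<in> sigma_sets UNIV (Collect closed)"
    using A by (simp add: borel_eq_closed)
  ultimately show ?thesis
  proof (induction rule: sigma_sets_induct_disjoint)
    case (basic A)
    then have cl: "closed A" by simp
    \<comment> \<open>The empty set is separated because \<open>infdist t {}\<close> is 0 by
      convention, so the cut-off functions would tend to 1 instead of 0.\<close>
    show ?case
    proof (cases "A = {}")
      case True
      then show ?thesis using const[of 0] by (simp add: indicator_def[abs_def])
    next
      case False
      define g where "g k t = complex_of_real (max 0 (1 - real k * infdist t A))" for k t
      show ?thesis
      proof (rule trig_approximable_dominated[OF p _ _ one, of g])
        show "trig_approximable p (g k)" for k
          unfolding g_def by (intro trig_approximable_continuous p continuous_intros)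
        show "indicator A \<in> borel_measurable circle"
          using cl by (intro borel_measurable_circleI borel_measurable_indicator) auto
        fix t :: complex
        show "norm (g k t) \<le> norm (1::complex)" for k
          unfolding g_def norm_of_real
          using mult_nonneg_nonneg[OF of_nat_0_le_iff infdist_nonneg, of k t A] by (auto simp: max_def)
        show "(\<lambda>k. g k t) \<longlonglongrightarrow> indicator A t"
        proof (cases "t \<in> A")
          case False
          then have pos: "0 < infdist t A"
            using cl \<open>A \<noteq> {}\<close> infdist_nonneg[of t A] by (simp add: in_closed_iff_infdist_zero less_le)
          obtain n where n: "1 < real n * infdist t A" using reals_Archimedean3[OF pos, rule_format, of 1] by blast
          have "g k t = 0" if "n \<le> k" for k
          proof -
            have "real n * infdist t A \<le> real k * infdist t A" using that pos by simp
            then show ?thesis using n by (simp add: g_def)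
          qed
          then have "\<forall>\<^sub>F k in sequentially. g k t = 0" by (auto simp: eventually_sequentially)
          then show ?thesis using False by (simp add: tendsto_eventually)
        qed (simp add: g_def)
      qed
    qed
  next
    case empty
    then show ?case using const[of 0] by (simp add: indicator_def[abs_def])
  next
    case (compl A)
    have "trig_approximable p (\<lambda>t. 1 + (-1) * indicator A t)"
      by (intro trig_approximable_add trig_approximable_scale const compl p0)
    also have "(\<lambda>t. 1 + (-1) * indicator A t) = (indicator (UNIV - A) :: complex \<Rightarrow> complex)"
      by (auto simp: indicator_def fun_eq_iff)
    finally show ?case .
  next
    case (union A)
    have A: "A i \<in> sets borel" for i using union.hyps(2) by (auto simp: borel_eq_closed)
    have fin: "trig_approximable p (indicator (\<Union>i<n. A i))" for n :: nat
    proof (induction n)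
      case 0
      then show ?case using const[of 0] by (simp add: indicator_def[abs_def])
    next
      case (Suc n)
      have "A n \<inter> A i = {}" if "i < n" for i
        using union.hyps(1) that by (simp add: disjoint_family_on_def)
      then have "A n \<inter> (\<Union>i<n. A i) = {}" by blast
      then have "(indicator (\<Union>i<Suc n. A i) :: complex \<Rightarrow> complex) = (\<lambda>t. indicator (A n) t + indicator (\<Union>i<n. A i) t)"
        by (intro ext) (auto simp: lessThan_Suc indicator_def)
      then show ?case using trig_approximable_add[OF p0 union.IH[of n] Suc] by simp
    qed
    show ?case
    proof (rule trig_approximable_dominated[OF p fin _ one])
      show "indicator (\<Union> (range A)) \<in> borel_measurable circle"
        using A by (intro borel_measurable_circleI borel_measurable_indicator) auto
      show "(\<lambda>k. indicator (\<Union>i<k. A i) t) \<longlonglongrightarrow> (indicator (\<Union> (range A)) t :: complex)" for t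
        by (rule LIMSEQ_indicator_UN)
      show "norm (indicator (\<Union>i<k. A i) t :: complex) \<le> norm (1::complex)" for k t
        by (simp add: indicator_def)
    qed
  qed
qed

lemma trig_approximable_Lp:
  assumes p: "0 < p" and f: "f \<in> Lp p"
  shows "trig_approximable p f"
proof -
  have p0: "0 \<le> p" using p by simp
  obtain s where s0: "\<forall>i. simple_function circle (s i)"
    "\<forall>t\<in>space circle. (\<lambda>i. s i t) \<longlonglongrightarrow> f t"
    "\<forall>i. \<forall>t\<in>space circle. dist (s i t) 0 \<le> 2 * dist (f t) 0"
    using borel_measurable_implies_sequence_metric[OF Lp_measurable[OF f], of 0] by blast
  have s: "\<And>i. simple_function circle (s i)"
    "\<And>t. t \<in> sphere 0 1 \<Longrightarrow> (\<lambda>i. s i t) \<longlonglongrightarrow> f t"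
    "\<And>i t. t \<in> sphere 0 1 \<Longrightarrow> norm (s i t) \<le> 2 * norm (f t)"
    using s0 by auto
  \<comment> \<open>The same simple function written as a linear combination of indicators of Borel
    sets. It agrees with \<open>s i\<close> on the circle, which is all that matters.\<close>
  define s' where "s' i t = (\<Sum>y\<in>s i ` sphere 0 1. y * indicator (s i -` {y} \<inter> sphere 0 1) t)" for i t
  have eq: "s' i t = s i t" if "t \<in> sphere 0 1" for i t
  proof -
    have fin: "finite (s i ` sphere 0 1)" using simple_functionD(1)[OF s(1)[of i]] by simp
    have "s' i t = (\<Sum>y\<in>s i ` sphere 0 1. if y = s i t then y else 0)"
      unfolding s'_def using that by (intro sum.cong) (auto simp: indicator_def)
    also have "\<dots> = s i t" using that fin by (simp add: sum.delta)
    finally show ?thesis .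
  qed
  have s': "trig_approximable p (s' i)" for i
  proof -
    have fin: "finite (s i ` sphere 0 1)" using simple_functionD(1)[OF s(1)[of i]] by simp
    have "trig_approximable p (\<lambda>t. \<Sum>y\<in>F. y * indicator (s i -` {y} \<inter> sphere 0 1) t)" if "finite F" for F
      using that
    proof (induction F)
      case empty
      have "trig_approximable p (\<lambda>t. 0)" by (intro trig_approximable_continuous p continuous_intros)
      then show ?case by simp
    next
      case (insert y F)
      have "s i -` {y} \<inter> sphere 0 1 \<in> sets circle"
        using simple_functionD(2)[OF s(1)[of i], of "{y}"] by simp
      then have "s i -` {y} \<inter> sphere 0 1 \<in> sets borel"
        by (simp add: sets_circle sets_restrict_space_iff)
      with insert.IH show ?case
        unfolding sum.insert[OF insert.hyps]
        by (intro trig_approximable_add trig_approximable_scale trig_approximable_indicator p p0)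
    qed
    then show ?thesis unfolding s'_def[abs_def] using fin by blast
  qed
  show ?thesis
  proof (rule trig_approximable_dominated[OF p s' Lp_measurable[OF f] Lp_scale(1)[OF f, of 2]])
    fix t :: complex assume t: "t \<in> sphere 0 1"
    show "(\<lambda>i. s' i t) \<longlonglongrightarrow> f t" using s(2)[OF t] by (simp add: eq[OF t])
    show "norm (s' i t) \<le> norm (2 * f t)" for i using s(3)[OF t] by (simp add: eq[OF t] norm_mult)
  qed
qed

section \<open>Fourier coefficients determine a function almost everywhere\<close>

lemma fourier_coeff_poly:
  "fourier_coeff (poly q) n = (if n \<ge> 0 then coeff q (nat n) else 0)"
proof -
  have "poly q = (\<lambda>t. \<Sum>i\<le>degree q. coeff q i * t powi int i)"
    by (simp add: poly_altdef fun_eq_iff)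
  then have "fourier_coeff (poly q) n = (\<Sum>i\<le>degree q. coeff q i * (if n = int i then 1 else 0))"
    by (simp only: fourier_coeff_sum[of 2] fourier_coeff_scale fourier_coeff_powi Lp_scale Lp_Linf[OF _ Linf_powi])
  also have "\<dots> = (if n \<ge> 0 then coeff q (nat n) else 0)"
  proof (cases "n \<ge> 0")
    case True
    then have "(\<Sum>i\<le>degree q. coeff q i * (if n = int i then 1 else 0)) = (\<Sum>i\<le>degree q. if i = nat n then coeff q i else 0)"
      by (intro sum.cong) auto
    also have "\<dots> = coeff q (nat n)" by (auto simp: coeff_eq_0 not_le)
    finally show ?thesis using True by simp
  qed (auto intro!: sum.neutral)
  finally show ?thesis .
qed

text \<open>The antianalytic part starts at \<open>t^-1\<close>, so coefficient \<open>k\<close> of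
  \<open>r\<close> sits at frequency \<open>- k - 1\<close>.\<close>

lemma fourier_coeff_trig_poly:
  "fourier_coeff (trig_poly q r) n = (if n \<ge> 0 then coeff q (nat n) else coeff r (nat (- n - 1)))"
proof -
  have "fourier_coeff (\<lambda>t. cnj t * poly r (cnj t)) n = fourier_coeff (poly (pCons 0 r)) (- n)"
    using fourier_coeff_cnj_arg[of "poly (pCons 0 r)" n] Lp_measurable[OF Lp_poly[of 1]] by simp
  also have "\<dots> = (if n \<ge> 0 then 0 else coeff r (nat (- n - 1)))"
  proof (cases "n \<ge> 0")
    case False
    then have "nat (- n) = Suc (nat (- n - 1))" by simp
    then show ?thesis using False by (simp add: fourier_coeff_poly)
  qed (auto simp: fourier_coeff_poly)
  finally have "fourier_coeff (\<lambda>t. cnj t * poly r (cnj t)) n = (if n \<ge> 0 then 0 else coeff r (nat (- n - 1)))" .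
  moreover have "(\<lambda>t. cnj t * poly r (cnj t)) \<in> Lp 1"
    by (intro Lp_continuous continuous_intros) auto
  ultimately show ?thesis
    unfolding trig_poly_def using fourier_coeff_add[of 1 "poly q" "\<lambda>t. cnj t * poly r (cnj t)" n] Lp_poly[of 1 q]
    by (simp add: fourier_coeff_poly)
qed

lemma integral_mult_trig_poly_eq_0:
  assumes p: "1 \<le> p" and f: "f \<in> Lp p" and 0: "\<And>n. fourier_coeff f n = 0"
  shows "(LINT t|circle. f t * trig_poly q r t) = 0"
proof -
  have p0: "0 \<le> p" using p by simp
  have i: "integrable circle (\<lambda>t. f t * t powi n)" "(LINT t|circle. f t * t powi n) = 0" for n
    using fourier_coeff_integrable[OF p f] 0[of "- n"] by (auto simp: fourier_coeff_def)
  have "(LINT t|circle. f t * trig_poly q r t) = 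
      (LINT t|circle. (\<Sum>k\<le>degree q. coeff q k * (f t * t powi int k)) + (\<Sum>k\<le>degree r. coeff r k * (f t * t powi (- int (Suc k)))))"
  proof (intro Bochner_Integration.integral_cong refl)
    fix t assume "t \<in> space circle"
    then have c: "cnj t = inverse t" by (simp add: cnj_on_circle)
    have "cnj t * poly r (cnj t) = (\<Sum>k\<le>degree r. coeff r k * t powi (- int (Suc k)))"
      unfolding c poly_altdef sum_distrib_left
      by (intro sum.cong) (auto simp: power_int_minus power_inverse simp del: of_nat_Suc)
    moreover have "poly q t = (\<Sum>k\<le>degree q. coeff q k * t powi int k)" by (simp add: poly_altdef)
    ultimately show "f t * trig_poly q r t = (\<Sum>k\<le>degree q. coeff q k * (f t * t powi int k)) + (\<Sum>k\<le>degree r. coeff r k * (f t * t powi (- int (Suc k))))"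
      unfolding trig_poly_def by (simp add: distrib_left sum_distrib_left mult.left_commute)
  qed
  also have "\<dots> = 0"
    by (subst Bochner_Integration.integral_add)
       (auto simp: i simp del: of_nat_Suc power_int_of_nat intro!: Bochner_Integration.integrable_sum integrable_mult_right)
  finally show ?thesis .
qed

text \<open>Tested against \<open>cnj (sgn f)\<close>, which is bounded and hence approximable by trigonometric
  polynomials in the norm of the conjugate exponent.\<close>

lemma fourier_coeff_zero_imp_AE_zero:
  assumes p: "1 < p" and f: "f \<in> Lp p" and 0: "\<And>n. fourier_coeff f n = 0"
  shows "AE t in circle. f t = 0"
proof -
  define q where "q = p / (p - 1)"
  have q: "1 < q" "1 / p + 1 / q = 1" using p by (auto simp: q_def field_simps)
  define g where "g t = cnj (sgn (f t))" for t
  have [measurable]: "f \<in> borel_measurable circle" by (rule Lp_measurable[OF f])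
  have "(\<lambda>t. sgn (f t)) \<in> borel_measurable circle"
    unfolding sgn_div_norm by measurable
  then have gm: "g \<in> borel_measurable circle"
    unfolding g_def[abs_def]
    by (rule measurable_compose) (intro borel_measurable_continuous_onI continuous_intros)
  have "g \<in> Linf"
    unfolding Linf_def using gm by (auto intro!: exI[of _ 1] AE_I2 simp: g_def norm_sgn)
  then have g: "g \<in> Lp q" using q by (intro Lp_Linf) auto
  have fg: "f t * g t = of_real (norm (f t))" for t
  proof (cases "f t = 0")
    case False
    have "f t * g t = (f t * cnj (f t)) / of_real (norm (f t))"
      by (simp add: g_def sgn_div_norm scaleR_conv_of_real divide_inverse)
    then show ?thesis using False by (simp add: complex_norm_square[symmetric] power2_eq_square)
  qed (simp add: g_def)
  have fi: "integrable circle f" using p f by (intro Lp_integrable(1)[of p]) auto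
  have *: "(LINT t|circle. norm (f t)) \<le> d * (Lp_pow p f + 1)" if d: "0 < d" for d
  proof -
    \<comment> \<open>Young's inequality is applied to \<open>(c |f|) (|e| / c)\<close>. With
      \<open>c^p = d\<close> the first term costs \<open>d |f|^p\<close>, and the approximation
      \<open>u, v\<close> is chosen afterwards, so fine that the integral of the second is at most
      \<open>d\<close>.\<close>
    define c where "c = d powr (1 / p)"
    have c: "0 < c" "c powr p = d" using d p by (auto simp: c_def powr_powr)
    obtain u v where uv: "Lp_pow q (\<lambda>t. g t - trig_poly u v t) < d * c powr q"
      using trig_approximable_Lp[of q g] g q c d unfolding trig_approximable_def by force
    let ?e = "\<lambda>t. g t - trig_poly u v t"
    have e: "?e \<in> Lp q" using q by (intro Lp_diff g Lp_trig_poly) auto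
    have bnd: "integrable circle (\<lambda>t. d * norm (f t) powr p + norm (?e t) powr q / c powr q)"
      using Lp_integrable_powr[OF f] Lp_integrable_powr[OF e] by simp
    have pt: "norm (f t * ?e t) \<le> d * norm (f t) powr p + norm (?e t) powr q / c powr q" for t
    proof -
      have "norm (f t * ?e t) = (c * norm (f t)) * (norm (?e t) / c)" using c by (simp add: norm_mult)
      also have "\<dots> \<le> (c * norm (f t)) powr p / p + (norm (?e t) / c) powr q / q"
        using p q c by (intro Youngs_inequality) auto
      also have "\<dots> \<le> (c * norm (f t)) powr p / 1 + (norm (?e t) / c) powr q / 1"
        using p q by (intro add_mono divide_left_mono) auto
      also have "\<dots> = d * norm (f t) powr p + norm (?e t) powr q / c powr q"
        using c by (simp add: powr_mult powr_divide)
      finally show ?thesis .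
    qed
    have fe: "integrable circle (\<lambda>t. f t * ?e t)"
      using pt Lp_measurable[OF e]
      by (intro Bochner_Integration.integrable_bound[OF bnd] AE_I2) (auto intro: order_trans[OF _ abs_ge_self])
    have ft: "integrable circle (\<lambda>t. f t * trig_poly u v t)"
      using Lp_mult_Linf[OF _ Linf_continuous[OF continuous_trig_poly] f, of u v] p
      by (intro Lp_integrable(1)[of p]) (auto simp: mult.commute)
    have "complex_of_real (LINT t|circle. norm (f t)) = (LINT t|circle. f t * ?e t + f t * trig_poly u v t)"
      by (simp add: fg flip: distrib_left)
    also have "\<dots> = (LINT t|circle. f t * ?e t)"
      using fe ft integral_mult_trig_poly_eq_0[OF _ f 0, of u v] p by simp
    finally have "norm (complex_of_real (LINT t|circle. norm (f t))) = norm (LINT t|circle. f t * ?e t)"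
      by simp
    then have "(LINT t|circle. norm (f t)) \<le> norm (LINT t|circle. f t * ?e t)"
      unfolding norm_of_real by linarith
    also have "\<dots> \<le> (LINT t|circle. norm (f t * ?e t))" by (rule integral_norm_bound)
    also have "\<dots> \<le> (LINT t|circle. d * norm (f t) powr p + norm (?e t) powr q / c powr q)"
      using fe bnd pt by (intro integral_mono) auto
    also have "\<dots> = d * Lp_pow p f + Lp_pow q ?e / c powr q"
      using Lp_integrable_powr[OF f] Lp_integrable_powr[OF e] by (simp add: Lp_pow_def)
    also have "Lp_pow q ?e / c powr q \<le> d" using uv c by (simp add: field_simps)
    finally show ?thesis by (simp add: algebra_simps)
  qed
  have "(LINT t|circle. norm (f t)) \<le> 0"
  proof (rule field_le_epsilon)
    fix e :: real assume "0 < e"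
    then show "(LINT t|circle. norm (f t)) \<le> 0 + e"
      using *[of "e / (Lp_pow p f + 1)"] Lp_pow_nonneg[of p f] by simp
  qed
  moreover have "0 \<le> (LINT t|circle. norm (f t))" by (rule integral_nonneg_AE) simp
  ultimately have "(LINT t|circle. norm (f t)) = 0" by simp
  then show ?thesis using fi by (simp add: integral_nonneg_eq_0_iff_AE)
qed

lemma fourier_coeff_eq_imp_AE_eq:
  assumes p: "1 < p" and "f \<in> Lp p" "g \<in> Lp p" "\<And>n. fourier_coeff f n = fourier_coeff g n"
  shows "AE t in circle. f t = g t"
proof -
  have "AE t in circle. f t - g t = 0"
    using assms by (intro fourier_coeff_zero_imp_AE_zero[OF p] Lp_diff) (auto simp: fourier_coeff_diff[of p])
  then show ?thesis by simp
qed

section \<open>Completeness of \<open>L^p\<close> and existence of the projection\<close>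

lemma Lp_Fatou:
  assumes u: "\<And>k. u k \<in> Lp p" "\<And>k. Lp_pow p (u k) \<le> M" and p: "0 < p"
    and v: "v \<in> borel_measurable circle" and lim: "AE t in circle. (\<lambda>k. u k t) \<longlonglongrightarrow> v t"
  shows "v \<in> Lp p" "Lp_pow p v \<le> M"
proof -
  have M: "0 \<le> M" using Lp_pow_nonneg[of p "u 0"] u(2)[of 0] by linarith
  have [measurable]: "u k \<in> borel_measurable circle" for k by (rule Lp_measurable[OF u(1)])
  note v [measurable]
  have "(\<integral>\<^sup>+t. ennreal (norm (v t) powr p) \<partial>circle) = (\<integral>\<^sup>+t. liminf (\<lambda>k. ennreal (norm (u k t) powr p)) \<partial>circle)"
  proof (rule nn_integral_cong_AE)
    show "AE t in circle. ennreal (norm (v t) powr p) = liminf (\<lambda>k. ennreal (norm (u k t) powr p))"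
      using lim
    proof eventually_elim
      case (elim t)
      have "(\<lambda>k. ennreal (norm (u k t) powr p)) \<longlonglongrightarrow> ennreal (norm (v t) powr p)"
        using p by (intro tendsto_ennrealI tendsto_powr' tendsto_norm elim tendsto_const) auto
      then show ?case by (intro lim_imp_Liminf[symmetric]) auto
    qed
  qed
  also have "\<dots> \<le> liminf (\<lambda>k. \<integral>\<^sup>+t. ennreal (norm (u k t) powr p) \<partial>circle)"
    by (rule nn_integral_liminf) measurable
  also have "\<dots> \<le> liminf (\<lambda>k::nat. ennreal M)"
  proof (intro Liminf_mono always_eventually allI)
    fix k
    have "(\<integral>\<^sup>+t. ennreal (norm (u k t) powr p) \<partial>circle) = ennreal (Lp_pow p (u k))"
      unfolding Lp_pow_def by (rule nn_integral_eq_integral[OF Lp_integrable_powr[OF u(1)]]) simp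
    then show "(\<integral>\<^sup>+t. ennreal (norm (u k t) powr p) \<partial>circle) \<le> ennreal M"
      using u(2)[of k] by (simp add: ennreal_leI)
  qed
  also have "\<dots> = ennreal M" by (simp add: Liminf_const)
  finally have le: "(\<integral>\<^sup>+t. ennreal (norm (v t) powr p) \<partial>circle) \<le> ennreal M" .
  then have i: "integrable circle (\<lambda>t. norm (v t) powr p)"
    by (intro integrableI_bounded) (auto intro: le_less_trans)
  then show "v \<in> Lp p" using v by (simp add: Lp_def)
  show "Lp_pow p v \<le> M"
    using le nn_integral_eq_integral[OF i] M by (simp add: Lp_pow_def)
qed

text \<open>The sequence is also Cauchy in \<open>L^1\<close>, so a subsequence converges almost
  everywhere to some \<open>g\<close>. Fatou's lemma, applied to \<open>u i - u (r k)\<close> as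
  \<open>k\<close> grows, then bounds \<open>u i - g\<close> in \<open>L^p\<close>.\<close>

lemma Lp_complete:
  assumes p: "1 \<le> p" and u: "\<And>k. u k \<in> Lp p"
    and cauchy: "\<And>e. 0 < e \<Longrightarrow> \<exists>N. \<forall>i\<ge>N. \<forall>j\<ge>N. Lp_pow p (\<lambda>t. u i t - u j t) \<le> e"
  obtains g where "g \<in> Lp p" "(\<lambda>k. Lp_pow p (\<lambda>t. u k t - g t)) \<longlonglongrightarrow> 0"
proof -
  have p0: "0 \<le> p" "0 < p" using p by auto
  have [measurable]: "u k \<in> borel_measurable circle" for k by (rule Lp_measurable[OF u])
  obtain r where r: "strict_mono r" "AE t in circle. Cauchy (\<lambda>i. u (r i) t)"
  proof (rule cauchy_L1_AE_cauchy_subseq[of circle u])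
    show "integrable circle (u n)" for n by (rule Lp_integrable(1)[OF p u])
    fix e :: real assume e: "0 < e"
    \<comment> \<open>Chosen so that \<open>(e / 4) powr (1 - p) * d = e / 4\<close>; the embedding
      estimate then gives at most \<open>e / 2\<close>.\<close>
    define d where "d = e / 4 / (e / 4) powr (1 - p)"
    have d: "0 < d" "(e / 4) powr (1 - p) * d = e / 4" using e by (auto simp: d_def)
    obtain N where N: "\<forall>i\<ge>N. \<forall>j\<ge>N. Lp_pow p (\<lambda>t. u i t - u j t) \<le> d" using cauchy[OF d(1)] by blast
    have "(LINT t|circle. norm (u i t - u j t)) < e" if "N \<le> i" "N \<le> j" for i j
    proof -
      have "(LINT t|circle. norm (u i t - u j t)) \<le> e / 4 + (e / 4) powr (1 - p) * Lp_pow p (\<lambda>t. u i t - u j t)"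
        using e by (intro Lp_integrable(2)[OF p Lp_diff(1)[OF p0(1) u u]]) simp
      also have "(e / 4) powr (1 - p) * Lp_pow p (\<lambda>t. u i t - u j t) \<le> (e / 4) powr (1 - p) * d"
        using N that by (intro mult_left_mono) auto
      finally show ?thesis using d(2) e by simp
    qed
    then show "\<exists>N. \<forall>i\<ge>N. \<forall>j\<ge>N. (LINT t|circle. norm (u i t - u j t)) < e" by blast
  qed blast
  define g where "g t = lim (\<lambda>i. u (r i) t)" for t
  have [measurable]: "g \<in> borel_measurable circle"
    unfolding g_def[abs_def] by (rule borel_measurable_lim_metric) measurable
  have lim: "AE t in circle. (\<lambda>i. u (r i) t) \<longlonglongrightarrow> g t"
    using r(2) by eventually_elim (simp add: g_def Cauchy_convergent_iff convergent_LIMSEQ_iff)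
  have key: "\<exists>N. \<forall>i\<ge>N. (\<lambda>t. u i t - g t) \<in> Lp p \<and> Lp_pow p (\<lambda>t. u i t - g t) \<le> e" if e: "0 < e" for e
  proof -
    obtain N where N: "\<And>i j. N \<le> i \<Longrightarrow> N \<le> j \<Longrightarrow> Lp_pow p (\<lambda>t. u i t - u j t) \<le> e"
      using cauchy[OF e] by blast
    have "(\<lambda>t. u i t - g t) \<in> Lp p \<and> Lp_pow p (\<lambda>t. u i t - g t) \<le> e" if i: "N \<le> i" for i
    proof -
      have rN: "N \<le> r (k + N)" for k
        using seq_suble[OF r(1), of "k + N"] by linarith
      have "AE t in circle. (\<lambda>k. u i t - u (r (k + N)) t) \<longlonglongrightarrow> u i t - g t"
        using lim by eventually_elim (intro tendsto_diff tendsto_const LIMSEQ_ignore_initial_segment)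
      then show ?thesis
        using Lp_Fatou[of "\<lambda>k t. u i t - u (r (k + N)) t" p e "\<lambda>t. u i t - g t"]
          Lp_diff(1)[OF p0(1) u u] N[OF i rN] p0 by auto
    qed
    then show ?thesis by blast
  qed
  obtain N where N: "(\<lambda>t. u N t - g t) \<in> Lp p" using key[of 1] by auto
  have "g \<in> Lp p"
    using Lp_diff(1)[OF p0(1) u[of N] N] by simp
  moreover have "(\<lambda>k. Lp_pow p (\<lambda>t. u k t - g t)) \<longlonglongrightarrow> 0"
  proof (rule LIMSEQ_I)
    fix e :: real assume "0 < e"
    then obtain N where N: "\<And>i. N \<le> i \<Longrightarrow> Lp_pow p (\<lambda>t. u i t - g t) \<le> e / 2"
      using key[of "e / 2"] by auto
    show "\<exists>N. \<forall>i\<ge>N. norm (Lp_pow p (\<lambda>t. u i t - g t) - 0) < e"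
    proof (intro exI allI impI)
      fix i assume "N \<le> i"
      from N[OF this] \<open>0 < e\<close> Lp_pow_nonneg[of p "\<lambda>t. u i t - g t"]
      show "norm (Lp_pow p (\<lambda>t. u i t - g t) - 0) < e" by simp
    qed
  qed
  ultimately show ?thesis by (rule that)
qed

text \<open>The analytic parts of trigonometric polynomials approximating \<open>f\<close> form a
  Cauchy sequence by \<open>M_Riesz\<close>, and coefficients are continuous in \<open>L^p\<close>.
  The approximating polynomials are kept in the conclusion because they yield the density of
  polynomials in \<open>H^p\<close>.\<close>

theorem riesz_projection_exists:
  assumes p: "1 < p" and f: "f \<in> Lp p"
  obtains g q where "g \<in> Lp p" "\<And>n. fourier_coeff g n = (if n \<ge> 0 then fourier_coeff f n else 0)"
    "(\<lambda>k. Lp_pow p (\<lambda>t. poly (q k) t - g t)) \<longlonglongrightarrow> 0"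
proof -
  have p0: "0 \<le> p" "0 < p" "1 \<le> p" using p by auto
  obtain C where C: "0 \<le> C" "\<And>q r. Lp_pow p (poly q) \<le> C * Lp_pow p (trig_poly q r)"
    using M_Riesz[OF p] unfolding riesz_bounded_def by blast
  have "\<forall>k. \<exists>q r. Lp_pow p (\<lambda>t. f t - trig_poly q r t) < 1 / real (Suc k)"
    using trig_approximable_Lp[OF p0(2) f] unfolding trig_approximable_def by simp
  then obtain q r where qr: "\<And>k. Lp_pow p (\<lambda>t. f t - trig_poly (q k) (r k) t) < 1 / real (Suc k)"
    by metis
  let ?T = "\<lambda>k. trig_poly (q k) (r k)"
  have diff: "Lp_pow p (\<lambda>t. poly (q i) t - poly (q j) t)
      \<le> C * (2 powr p * (1 / real (Suc i) + 1 / real (Suc j)))" for i j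
  proof -
    have "Lp_pow p (\<lambda>t. poly (q i) t - poly (q j) t) = Lp_pow p (poly (q i - q j))"
      by (simp add: Lp_pow_def)
    also have "\<dots> \<le> C * Lp_pow p (trig_poly (q i - q j) (r i - r j))" by (rule C(2))
    also have "trig_poly (q i - q j) (r i - r j) = (\<lambda>t. ?T i t - ?T j t)"
      by (simp add: trig_poly_diff)
    also have "C * Lp_pow p (\<lambda>t. ?T i t - ?T j t)
        \<le> C * (2 powr p * (Lp_pow p (\<lambda>t. ?T i t - f t) + Lp_pow p (\<lambda>t. f t - ?T j t)))"
      by (intro mult_left_mono C(1) Lp_pow_triangle p0 f Lp_trig_poly)
    also have "\<dots> \<le> C * (2 powr p * (1 / real (Suc i) + 1 / real (Suc j)))"
      using qr[of i] qr[of j] C(1)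
      by (intro mult_left_mono add_mono) (auto simp: Lp_pow_diff_commute[of p "?T i"])
    finally show ?thesis .
  qed
  obtain g where g: "g \<in> Lp p" "(\<lambda>k. Lp_pow p (\<lambda>t. poly (q k) t - g t)) \<longlonglongrightarrow> 0"
  proof (rule Lp_complete[OF p0(3), of "\<lambda>k. poly (q k)"])
    show "poly (q k) \<in> Lp p" for k by (rule Lp_poly[OF p0(1)])
    fix e :: real assume e: "0 < e"
    have "(\<lambda>N. C * (2 powr p * (1 / real (Suc N) + 1 / real (Suc N)))) \<longlonglongrightarrow> C * (2 powr p * (0 + 0))"
      by (intro tendsto_intros LIMSEQ_inverse_real_of_nat[unfolded inverse_eq_divide])
    then have "\<forall>\<^sub>F N in sequentially. C * (2 powr p * (1 / real (Suc N) + 1 / real (Suc N))) < e"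
      by (rule order_tendstoD(2)) (use e in simp)
    then obtain N where N: "C * (2 powr p * (1 / real (Suc N) + 1 / real (Suc N))) < e"
      by (auto simp: eventually_sequentially)
    have "Lp_pow p (\<lambda>t. poly (q i) t - poly (q j) t) \<le> e" if "N \<le> i" "N \<le> j" for i j
    proof -
      have "1 / real (Suc i) \<le> 1 / real (Suc N)" "1 / real (Suc j) \<le> 1 / real (Suc N)"
        using that by (auto intro!: divide_left_mono)
      then have "C * (2 powr p * (1 / real (Suc i) + 1 / real (Suc j))) \<le> C * (2 powr p * (1 / real (Suc N) + 1 / real (Suc N)))"
        by (intro mult_left_mono add_mono C(1)) auto
      then show ?thesis using diff[of i j] N by linarith
    qed
    then show "\<exists>N. \<forall>i\<ge>N. \<forall>j\<ge>N. Lp_pow p (\<lambda>t. poly (q i) t - poly (q j) t) \<le> e" by blast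
  qed blast
  have gl: "(\<lambda>k. fourier_coeff (poly (q k)) n) \<longlonglongrightarrow> fourier_coeff g n" for n
    by (rule fourier_coeff_tendsto[OF p0(3) Lp_poly[OF p0(1)] g])
  have "(\<lambda>k. Lp_pow p (\<lambda>t. ?T k t - f t)) \<longlonglongrightarrow> 0"
  proof (rule tendsto_sandwich[OF _ _ tendsto_const LIMSEQ_inverse_real_of_nat])
    show "\<forall>\<^sub>F k in sequentially. 0 \<le> Lp_pow p (\<lambda>t. ?T k t - f t)" by (simp add: Lp_pow_nonneg)
    show "\<forall>\<^sub>F k in sequentially. Lp_pow p (\<lambda>t. ?T k t - f t) \<le> inverse (real (Suc k))"
      using qr by (intro always_eventually allI) (auto simp: Lp_pow_diff_commute[of p _ f] inverse_eq_divide less_imp_le)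
  qed
  then have fl: "(\<lambda>k. fourier_coeff (?T k) n) \<longlonglongrightarrow> fourier_coeff f n" for n
    by (rule fourier_coeff_tendsto[OF p0(3) Lp_trig_poly[OF p0(1)] f])
  have "fourier_coeff g n = (if n \<ge> 0 then fourier_coeff f n else 0)" for n
  proof (cases "n \<ge> 0")
    case True
    then show ?thesis
      using LIMSEQ_unique[OF gl[of n]] fl[of n] by (simp add: fourier_coeff_poly fourier_coeff_trig_poly)
  next
    case False
    then show ?thesis using LIMSEQ_unique[OF gl[of n], of 0] by (simp add: fourier_coeff_poly)
  qed
  with g show ?thesis by (intro that)
qed

section \<open>Toeplitz plus Hankel operators\<close>

lemma Hp_Lp: "f \<in> Hp p \<Longrightarrow> f \<in> Lp p"
  by (simp add: Hp_def)

lemma Hp_coeff: "f \<in> Hp p \<Longrightarrow> n < 0 \<Longrightarrow> fourier_coeff f n = 0"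
  by (simp add: Hp_def)

lemma Hp_zero: "(\<lambda>t. 0) \<in> Hp p"
  by (simp add: Hp_def Lp_zero fourier_coeff_zero)

lemma Hp_scale: "f \<in> Hp p \<Longrightarrow> (\<lambda>t. c * f t) \<in> Hp p"
  by (simp add: Hp_def Lp_scale fourier_coeff_scale)

lemma Hp_add: "1 \<le> p \<Longrightarrow> f \<in> Hp p \<Longrightarrow> g \<in> Hp p \<Longrightarrow> (\<lambda>t. f t + g t) \<in> Hp p"
  by (simp add: Hp_def Lp_add fourier_coeff_add[of p])

lemma Hp_diff: "1 \<le> p \<Longrightarrow> f \<in> Hp p \<Longrightarrow> g \<in> Hp p \<Longrightarrow> (\<lambda>t. f t - g t) \<in> Hp p"
  by (simp add: Hp_def Lp_diff fourier_coeff_diff[of p])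

lemma Hp_sum:
  "1 \<le> p \<Longrightarrow> (\<And>i. i \<in> I \<Longrightarrow> f i \<in> Hp p) \<Longrightarrow> (\<lambda>t. \<Sum>i\<in>I. f i t) \<in> Hp p"
  by (induction I rule: infinite_finite_induct) (auto simp: Hp_zero intro!: Hp_add)

lemma Hp_poly: "0 \<le> p \<Longrightarrow> poly q \<in> Hp p"
  by (simp add: Hp_def Lp_poly fourier_coeff_poly)

lemma Hp_powi: "0 \<le> p \<Longrightarrow> 0 \<le> n \<Longrightarrow> (\<lambda>t. t powi n) \<in> Hp p"
  by (auto simp: Hp_def Lp_Linf Linf_powi fourier_coeff_powi)

lemma Hp_eqI:
  assumes p: "1 < p" and "f \<in> Hp p" "g \<in> Hp p" "\<And>n. n \<ge> 0 \<Longrightarrow> fourier_coeff f n = fourier_coeff g n"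
  shows "AE t in circle. f t = g t"
proof (rule fourier_coeff_eq_imp_AE_eq[OF p])
  show "fourier_coeff f n = fourier_coeff g n" for n
    using assms by (cases "n \<ge> 0") (auto simp: Hp_coeff)
qed (use assms in \<open>auto intro: Hp_Lp\<close>)

text \<open>An element of \<open>H^p\<close> is its own projection, and every projection is a limit
  of polynomials.\<close>

lemma Hp_poly_dense:
  assumes p: "1 < p" and y: "y \<in> Hp p"
  obtains q where "(\<lambda>k. Lp_pow p (\<lambda>t. poly (q k) t - y t)) \<longlonglongrightarrow> 0"
proof -
  have p0: "0 \<le> p" using p by simp
  obtain g q where g: "g \<in> Lp p" "\<And>n. fourier_coeff g n = (if n \<ge> 0 then fourier_coeff y n else 0)"
    "(\<lambda>k. Lp_pow p (\<lambda>t. poly (q k) t - g t)) \<longlonglongrightarrow> 0"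
    using riesz_projection_exists[OF p Hp_Lp[OF y]] by metis
  have "AE t in circle. g t = y t"
    using g y by (intro Hp_eqI[OF p]) (auto simp: Hp_def)
  then have ae: "AE t in circle. poly (q k) t - g t = poly (q k) t - y t" for k
    by eventually_elim simp
  have "Lp_pow p (\<lambda>t. poly (q k) t - g t) = Lp_pow p (\<lambda>t. poly (q k) t - y t)" for k
    using p0 g(1) Hp_Lp[OF y] by (intro Lp_cong_AE(2)[OF _ _ ae] Lp_diff Lp_measurable[where p = p] Lp_poly) auto
  then show ?thesis using g(3) that by simp
qed

lemma riesz_P:
  assumes p: "1 < p" and f: "f \<in> Lp p"
  shows "riesz_P p f \<in> Lp p" "fourier_coeff (riesz_P p f) n = (if n \<ge> 0 then fourier_coeff f n else 0)"
proof -
  have "\<exists>g. g \<in> Lp p \<and> (\<forall>n. fourier_coeff g n = (if n \<ge> 0 then fourier_coeff f n else 0))"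
    using riesz_projection_exists[OF p f] by metis
  from someI_ex[OF this] show "riesz_P p f \<in> Lp p"
    "fourier_coeff (riesz_P p f) n = (if n \<ge> 0 then fourier_coeff f n else 0)"
    unfolding riesz_P_def by blast+
qed

lemma riesz_P_Hp: "1 < p \<Longrightarrow> f \<in> Lp p \<Longrightarrow> riesz_P p f \<in> Hp p"
  by (simp add: Hp_def riesz_P)

lemma Lp_flip_J: "0 \<le> p \<Longrightarrow> f \<in> Lp p \<Longrightarrow> flip_J f \<in> Lp p"
  unfolding flip_J_def by (intro Lp_mult_Linf Linf_cnj Lp_cnj_arg)

lemma fourier_coeff_cong:
  assumes "\<And>t. t \<in> sphere 0 1 \<Longrightarrow> f t = g t"
  shows "fourier_coeff f n = fourier_coeff g n"
  unfolding fourier_coeff_def using assms by (intro Bochner_Integration.integral_cong) auto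

lemma fourier_coeff_powi_cnj:
  assumes "f \<in> borel_measurable circle"
  shows "fourier_coeff (\<lambda>t. t powi m * f (cnj t)) n = fourier_coeff f (m - n)"
  using fourier_coeff_powi_mult[of m "\<lambda>t. f (cnj t)" n] fourier_coeff_cnj_arg[OF assms, of "n - m"] by simp

lemma fourier_coeff_flip_J:
  assumes "f \<in> borel_measurable circle"
  shows "fourier_coeff (flip_J f) n = fourier_coeff f (- n - 1)"
proof -
  have "fourier_coeff (flip_J f) n = fourier_coeff (\<lambda>t. t powi (- 1) * f (cnj t)) n"
    by (rule fourier_coeff_cong) (simp add: flip_J_def cnj_on_circle power_int_minus)
  then show ?thesis by (simp only: fourier_coeff_powi_cnj[OF assms] minus_diff_commute)
qed

text \<open>\<open>J\<close> exchanges the frequencies \<open>n\<close> and \<open>- n - 1\<close>,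
  so it maps \<open>H^p\<close> into the negative frequencies, where \<open>Q\<close> acts as the
  identity.\<close>

lemma riesz_Q_flip_J:
  assumes p: "1 < p" and f: "f \<in> Hp p"
  shows "riesz_Q p (flip_J f) \<in> Lp p" "AE t in circle. riesz_Q p (flip_J f) t = flip_J f t"
proof -
  have J: "flip_J f \<in> Lp p" using p by (intro Lp_flip_J Hp_Lp f) simp
  show "riesz_Q p (flip_J f) \<in> Lp p"
    unfolding riesz_Q_def using p by (intro Lp_diff J riesz_P) auto
  have "AE t in circle. riesz_P p (flip_J f) t = 0"
    using f by (intro fourier_coeff_zero_imp_AE_zero[OF p] riesz_P[OF p J])
      (auto simp: riesz_P[OF p J] fourier_coeff_flip_J Lp_measurable[OF Hp_Lp] Hp_coeff)
  then show "AE t in circle. riesz_Q p (flip_J f) t = flip_J f t"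
    unfolding riesz_Q_def by eventually_elim simp
qed

lemma bounded_op_HpD:
  assumes B: "bounded_op_Hp p B" and p: "1 \<le> p"
  shows "f \<in> Hp p \<Longrightarrow> B f \<in> Hp p"
    and "f \<in> Hp p \<Longrightarrow> g \<in> Hp p \<Longrightarrow> AE t in circle. B (\<lambda>s. f s - g s) t = B f t - B g t"
    and "\<exists>C. \<forall>f\<in>Hp p. Lp_pow p (B f) \<le> C * Lp_pow p f"
proof -
  show mem: "f \<in> Hp p \<Longrightarrow> B f \<in> Hp p" for f using B by (simp add: bounded_op_Hp_def)
  show "AE t in circle. B (\<lambda>s. f s - g s) t = B f t - B g t" if f: "f \<in> Hp p" and g: "g \<in> Hp p"
  proof -
    have "AE t in circle. B (\<lambda>s. u s + v s) t = B u t + B v t" if "u \<in> Hp p" "v \<in> Hp p" for u v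
      using B that by (simp add: bounded_op_Hp_def)
    from this[OF Hp_diff[OF p f g] g] show ?thesis by eventually_elim simp
  qed
  obtain C where C: "\<And>f. f \<in> Hp p \<Longrightarrow> Lp_norm p (B f) \<le> C * Lp_norm p f"
    using B unfolding bounded_op_Hp_def by blast
  have pw: "Lp_norm p f powr p = Lp_pow p f" for f
    using p Lp_pow_nonneg[of p f] by (simp add: Lp_norm_def powr_powr flip: Lp_pow_def)
  \<comment> \<open>The definition leaves the sign of \<open>C\<close> open; the absolute value
    makes the bound monotone under powers.\<close>
  have "Lp_pow p (B f) \<le> \<bar>C\<bar> powr p * Lp_pow p f" if f: "f \<in> Hp p" for f
  proof -
    have nn: "0 \<le> Lp_norm p f" for f by (simp add: Lp_norm_def)
    have "Lp_norm p (B f) \<le> \<bar>C\<bar> * Lp_norm p f"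
      using C[OF f] mult_right_mono[OF abs_ge_self[of C] nn[of f]] by linarith
    then have "Lp_norm p (B f) powr p \<le> (\<bar>C\<bar> * Lp_norm p f) powr p"
      using p nn by (intro powr_mono2) auto
    then show ?thesis by (simp add: powr_mult pw)
  qed
  then show "\<exists>C. \<forall>f\<in>Hp p. Lp_pow p (B f) \<le> C * Lp_pow p f" by blast
qed

text \<open>\<open>B (f - g)\<close> has norm 0 when \<open>f - g\<close> does. Below, a polynomial
  in the range of \<open>A\<close> equals some \<open>A g\<close> only almost everywhere, and
  \<open>B\<close> has to be applied to both.\<close>

lemma bounded_op_Hp_cong_AE:
  assumes B: "bounded_op_Hp p B" and p: "1 \<le> p"
    and f: "f \<in> Hp p" and g: "g \<in> Hp p" and eq: "AE t in circle. f t = g t"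
  shows "AE t in circle. B f t = B g t"
proof -
  obtain C where C: "\<And>f. f \<in> Hp p \<Longrightarrow> Lp_pow p (B f) \<le> C * Lp_pow p f"
    using bounded_op_HpD(3)[OF B p] by blast
  have d: "(\<lambda>t. f t - g t) \<in> Hp p" by (rule Hp_diff[OF p f g])
  have "AE t in circle. f t - g t = 0" using eq by eventually_elim simp
  then have "Lp_pow p (\<lambda>t. f t - g t) = 0" using Lp_pow_eq_0_iff[OF Hp_Lp[OF d]] by simp
  then have "Lp_pow p (B (\<lambda>t. f t - g t)) = 0"
    using C[OF d] Lp_pow_nonneg[of p "B (\<lambda>t. f t - g t)"] by simp
  then have "AE t in circle. B (\<lambda>t. f t - g t) t = 0"
    using Lp_pow_eq_0_iff[OF Hp_Lp[OF bounded_op_HpD(1)[OF B p d]]] by simp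
  with bounded_op_HpD(2)[OF B p f g] show ?thesis by eventually_elim simp
qed

text \<open>The pairs \<open>(m, \<sigma>)\<close> of the four operators, in the order of the theorem, are \<open>(-2, -1)\<close>,
  \<open>(0, 1)\<close>, \<open>(-1, 1)\<close> and \<open>(-1, -1)\<close>.  The formula for the coefficients rests on \<open>Q J f = J f\<close>
  for \<open>f \<in> H\<^sup>p\<close>.\<close>

locale toeplitz_hankel =
  fixes p :: real and a :: "complex \<Rightarrow> complex" and \<sigma> :: complex and m :: int
    and A :: "(complex \<Rightarrow> complex) \<Rightarrow> complex \<Rightarrow> complex"
  assumes p: "1 < p" and a: "a \<in> GLinf"
    and sign: "m = -1 \<and> (\<sigma> = 1 \<or> \<sigma> = -1) \<or> m = 0 \<and> \<sigma> = 1 \<or> m = -2 \<and> \<sigma> = -1"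
    and A_Hp: "\<And>f. f \<in> Hp p \<Longrightarrow> A f \<in> Hp p"
    and A_coeff: "\<And>f n. f \<in> Hp p \<Longrightarrow> n \<ge> 0 \<Longrightarrow> fourier_coeff (A f) n =
      fourier_coeff (\<lambda>t. a t * (f t + \<sigma> * (t powi m * f (cnj t)))) n"
begin

section \<open>Linearity and continuity of the map sending \<open>f\<close> to
  \<open>a S f\<close>\<close>

lemma p_simps: "0 \<le> p" "0 < p" "1 \<le> p"
  using p by auto

lemma a_Linf: "a \<in> Linf"
  using a by (simp add: GLinf_def)

definition S :: "(complex \<Rightarrow> complex) \<Rightarrow> complex \<Rightarrow> complex" where
  "S f = (\<lambda>t. f t + \<sigma> * (t powi m * f (cnj t)))"

text \<open>Before projection the map is pointwise linear and defined on all of \<open>L^p\<close>.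
  Its coefficients at \<open>n \<ge> 0\<close> are those of \<open>A f\<close>, so linearity and
  continuity are used here rather than for \<open>A\<close>.\<close>

definition aS :: "(complex \<Rightarrow> complex) \<Rightarrow> complex \<Rightarrow> complex" where
  "aS f = (\<lambda>t. a t * S f t)"

lemma A_coeff': "f \<in> Hp p \<Longrightarrow> n \<ge> 0 \<Longrightarrow> fourier_coeff (A f) n = fourier_coeff (aS f) n"
  using A_coeff by (simp add: aS_def S_def)

lemma S_Lp:
  assumes f: "f \<in> Lp p"
  shows "S f \<in> Lp p" "Lp_pow p (S f) \<le> 2 powr p * 2 * Lp_pow p f"
proof -
  have 1: "(\<lambda>t. t powi m * f (cnj t)) \<in> Lp p"
    by (intro Lp_powi_mult p_simps Lp_cnj_arg f)
  have 2: "(\<lambda>t. \<sigma> * (t powi m * f (cnj t))) \<in> Lp p" by (rule Lp_scale[OF 1])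
  show "S f \<in> Lp p" unfolding S_def by (rule Lp_add[OF p_simps(1) f 2])
  have "Lp_pow p (\<lambda>t. \<sigma> * (t powi m * f (cnj t))) = norm \<sigma> powr p * Lp_pow p (\<lambda>t. t powi m * f (cnj t))"
    by (rule Lp_scale[OF 1])
  also have "norm \<sigma> = 1" using sign by auto
  also have "Lp_pow p (\<lambda>t. t powi m * f (cnj t)) = Lp_pow p (\<lambda>t. f (cnj t))"
    unfolding Lp_pow_def by (intro Bochner_Integration.integral_cong) (auto simp: norm_mult norm_power_int)
  also have "\<dots> = Lp_pow p f" by (rule Lp_cnj_arg[OF f])
  finally show "Lp_pow p (S f) \<le> 2 powr p * 2 * Lp_pow p f"
    using Lp_add(2)[OF p_simps(1) f 2] by (simp add: S_def)
qed

lemma aS_Lp: "f \<in> Lp p \<Longrightarrow> aS f \<in> Lp p"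
  unfolding aS_def by (intro Lp_mult_Linf p_simps a_Linf S_Lp)

lemma aS_bounded: "\<exists>C. \<forall>f\<in>Lp p. Lp_pow p (aS f) \<le> C * Lp_pow p f"
proof -
  obtain C where C: "0 \<le> C" "\<And>f. f \<in> Lp p \<Longrightarrow> Lp_pow p (\<lambda>t. a t * f t) \<le> C * Lp_pow p f"
    using Lp_Linf_mult[OF p_simps(1) a_Linf] by metis
  have "Lp_pow p (aS f) \<le> (C * (2 powr p * 2)) * Lp_pow p f" if f: "f \<in> Lp p" for f
  proof -
    have "Lp_pow p (aS f) \<le> C * Lp_pow p (S f)" unfolding aS_def by (rule C(2)[OF S_Lp(1)[OF f]])
    also have "\<dots> \<le> C * (2 powr p * 2 * Lp_pow p f)" by (intro mult_left_mono C(1) S_Lp f)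
    finally show ?thesis by (simp add: mult.assoc)
  qed
  then show ?thesis by blast
qed

lemma S_add: "S (\<lambda>t. f t + g t) t = S f t + S g t"
  and S_diff: "S (\<lambda>t. f t - g t) t = S f t - S g t"
  and S_scale: "S (\<lambda>t. c * f t) t = c * S f t"
  by (simp_all add: S_def algebra_simps)

lemma S_cong: "(\<And>t. t \<in> sphere 0 1 \<Longrightarrow> f t = g t) \<Longrightarrow> t \<in> sphere 0 1 \<Longrightarrow> S f t = S g t"
  by (simp add: S_def)

lemma coeff_aS_add:
  "f \<in> Lp p \<Longrightarrow> g \<in> Lp p \<Longrightarrow> fourier_coeff (aS (\<lambda>t. f t + g t)) n = fourier_coeff (aS f) n + fourier_coeff (aS g) n"
  using fourier_coeff_add[OF p_simps(3) aS_Lp aS_Lp, of f g n] by (simp add: aS_def S_add distrib_left)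

lemma coeff_aS_diff:
  "f \<in> Lp p \<Longrightarrow> g \<in> Lp p \<Longrightarrow> fourier_coeff (aS (\<lambda>t. f t - g t)) n = fourier_coeff (aS f) n - fourier_coeff (aS g) n"
  using fourier_coeff_diff[OF p_simps(3) aS_Lp aS_Lp, of f g n] by (simp add: aS_def S_diff right_diff_distrib)

lemma coeff_aS_scale: "fourier_coeff (aS (\<lambda>t. c * f t)) n = c * fourier_coeff (aS f) n"
  using fourier_coeff_scale[of c "aS f" n] by (simp add: aS_def S_scale mult.left_commute)

lemma coeff_aS_sum:
  assumes "\<And>i. i \<in> I \<Longrightarrow> f i \<in> Lp p"
  shows "fourier_coeff (aS (\<lambda>t. \<Sum>i\<in>I. f i t)) n = (\<Sum>i\<in>I. fourier_coeff (aS (f i)) n)"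
proof -
  have 0: "fourier_coeff (aS (\<lambda>t. 0)) n = 0" by (simp add: aS_def S_def fourier_coeff_zero)
  show ?thesis
    using assms
  proof (induction I rule: infinite_finite_induct)
    case (insert i I)
    then have "(\<lambda>t. \<Sum>i\<in>I. f i t) \<in> Lp p" by (intro Lp_sum p_simps) auto
    with insert show ?case by (simp add: coeff_aS_add)
  qed (simp_all add: 0)
qed

lemma coeff_aS_cong_AE:
  assumes f: "f \<in> Lp p" and g: "g \<in> Lp p" and eq: "AE t in circle. f t = g t"
  shows "fourier_coeff (aS f) n = fourier_coeff (aS g) n"
proof (rule fourier_coeff_cong_AE)
  show "aS f \<in> borel_measurable circle" "aS g \<in> borel_measurable circle"
    by (intro Lp_measurable[where p = p] aS_Lp f g)+
  show "AE t in circle. aS f t = aS g t"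
    using eq AE_circle_cnj[OF eq] by eventually_elim (simp add: aS_def S_def)
qed

lemma coeff_aS_tendsto:
  assumes f: "\<And>k. f k \<in> Lp p" and g: "g \<in> Lp p" and lim: "(\<lambda>k. Lp_pow p (\<lambda>t. f k t - g t)) \<longlonglongrightarrow> 0"
  shows "(\<lambda>k. fourier_coeff (aS (f k)) n) \<longlonglongrightarrow> fourier_coeff (aS g) n"
proof (rule fourier_coeff_tendsto[OF p_simps(3) aS_Lp[OF f] aS_Lp[OF g]])
  obtain C where C: "\<And>f. f \<in> Lp p \<Longrightarrow> Lp_pow p (aS f) \<le> C * Lp_pow p f"
    using aS_bounded by blast
  have le: "Lp_pow p (\<lambda>t. aS (f k) t - aS g t) \<le> C * Lp_pow p (\<lambda>t. f k t - g t)" for k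
    using C[OF Lp_diff(1)[OF p_simps(1) f g], of k] by (simp add: aS_def S_diff right_diff_distrib)
  show "(\<lambda>k. Lp_pow p (\<lambda>t. aS (f k) t - aS g t)) \<longlonglongrightarrow> 0"
    by (rule tendsto_sandwich[OF _ _ tendsto_const tendsto_mult_right_zero[OF lim, of C]])
       (auto simp: Lp_pow_nonneg le)
qed

text \<open>\<open>S f = 0\<close> means \<open>f_n = - \<sigma> f_(m-n)\<close>. For
  \<open>n \<ge> 0\<close> the index \<open>m - n\<close> is negative, and the right side vanishes,
  except when \<open>n = m = 0\<close>; then \<open>\<sigma> = 1\<close> gives
  \<open>2 f_0 = 0\<close>.\<close>

lemma S_injective:
  assumes f: "f \<in> Hp p" and 0: "AE t in circle. S f t = 0"
  shows "AE t in circle. f t = 0"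
proof (rule fourier_coeff_zero_imp_AE_zero[OF p Hp_Lp[OF f]])
  note fL = Hp_Lp[OF f]
  fix n
  have r: "(\<lambda>t. t powi m * f (cnj t)) \<in> Lp p"
    by (intro Lp_powi_mult p_simps Lp_cnj_arg fL)
  have S0: "fourier_coeff (S f) n = 0" for n
    using fourier_coeff_cong_AE[OF Lp_measurable[OF S_Lp(1)[OF fL]] _ 0, of n] by (simp add: fourier_coeff_zero)
  have S: "fourier_coeff f n + \<sigma> * fourier_coeff f (m - n) = 0" for n
    using S0[of n] fourier_coeff_add[OF p_simps(3) fL Lp_scale(1)[OF r], of \<sigma> n]
    by (simp add: S_def fourier_coeff_scale fourier_coeff_powi_cnj[OF Lp_measurable[OF fL]])
  show "fourier_coeff f n = 0"
  proof (cases "n < 0")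
    case False
    show ?thesis
    proof (cases "m - n < 0")
      case True
      then show ?thesis using S[of n] Hp_coeff[OF f] by simp
    next
      case neg: False
      then have "n = 0" "m = 0" "\<sigma> = 1" using False sign by auto
      then show ?thesis using S[of 0] by simp
    qed
  qed (use Hp_coeff[OF f] in simp)
qed

text \<open>Since \<open>\<sigma>^2 = 1\<close>, on the circle \<open>S\<close> takes the same value
  at \<open>t^j\<close> and at \<open>\<sigma> t^(m-j)\<close>, and one of the two exponents is
  usually nonnegative. The exception is \<open>m = -2\<close>, \<open>j = -1\<close>, where
  \<open>m - j = j\<close> and \<open>\<sigma> = -1\<close> gives \<open>S t^-1 = 0\<close>.\<close>

lemma S_powi_Hp: "\<exists>f\<in>Hp p. \<forall>t\<in>sphere 0 1. S f t = S (\<lambda>t. t powi j) t"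
proof -
  consider "0 \<le> j" | "0 \<le> m - j" | "m = -2" "\<sigma> = -1" "j = -1"
    using sign by fastforce
  then show ?thesis
  proof cases
    case 1
    then show ?thesis using Hp_powi[OF p_simps(1)] by blast
  next
    case 2
    have "S (\<lambda>t. \<sigma> * t powi (m - j)) t = S (\<lambda>t. t powi j) t" if t: "t \<in> sphere 0 1" for t
    proof -
      have t0: "t \<noteq> 0" and c: "cnj t = inverse t" using t cnj_on_circle by auto
      have ss: "\<sigma> * \<sigma> = 1" using sign by auto
      have pw: "t powi m * cnj t powi (m - j) = t powi j" "t powi m * cnj t powi j = t powi (m - j)"
        unfolding c using t0
        by (simp_all add: power_int_inverse power_int_diff field_simps)
      have "S (\<lambda>t. \<sigma> * t powi (m - j)) t
          = \<sigma> * t powi (m - j) + (\<sigma> * \<sigma>) * (t powi m * cnj t powi (m - j))"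
        by (simp only: S_def mult.assoc mult.left_commute)
      also have "\<dots> = t powi j + \<sigma> * (t powi m * cnj t powi j)"
        by (simp only: ss pw mult_1_left add.commute)
      finally show ?thesis by (simp only: S_def)
    qed
    then show ?thesis using Hp_scale[OF Hp_powi[OF p_simps(1) 2]] by blast
  next
    case 3
    have "S (\<lambda>t. 0) t = S (\<lambda>t. t powi j) t" if t: "t \<in> sphere 0 1" for t
    proof -
      have t0: "t \<noteq> 0" and c: "cnj t = inverse t" using t cnj_on_circle by auto
      show ?thesis unfolding S_def unfolding 3 c using t0 by (simp add: power_int_minus power2_eq_square)
    qed
    then show ?thesis using Hp_zero by blast
  qed
qed

text \<open>Each step peels off the constant term: with \<open>f = f0 + t h\<close> and
  \<open>h\<close> in \<open>H^p\<close>, the product \<open>t^-(n+1) f\<close> is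
  \<open>t^-n h\<close> plus a multiple of a single power, which \<open>S_powi_Hp\<close> moves into
  \<open>H^p\<close>.\<close>

lemma S_shift_Hp: "f \<in> Hp p \<Longrightarrow> \<exists>g\<in>Hp p. \<forall>t\<in>sphere 0 1. S g t = S (\<lambda>t. t powi (- int n) * f t) t"
proof (induction n arbitrary: f)
  case 0
  then show ?case by auto
next
  case (Suc n)
  define f0 where "f0 = fourier_coeff f 0"
  define h where "h t = t powi (-1) * (f t - f0 * t powi 0)" for t
  note fL = Hp_Lp[OF Suc.prems]
  have cL: "(\<lambda>t. f0 * t powi 0) \<in> Lp p" by (intro Lp_scale Lp_Linf Linf_powi p_simps)
  have h: "h \<in> Hp p"
  proof -
    have "h \<in> Lp p" unfolding h_def[abs_def]
      by (intro Lp_powi_mult Lp_diff fL cL p_simps)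
    moreover have "fourier_coeff h n = 0" if "n < 0" for n
    proof -
      have "fourier_coeff h n = fourier_coeff (\<lambda>t. f t - f0 * t powi 0) (n + 1)"
        unfolding h_def[abs_def] using fourier_coeff_powi_mult[of "-1" _ n] by simp
      also have "\<dots> = fourier_coeff f (n + 1) - f0 * fourier_coeff (\<lambda>t. t powi 0) (n + 1)"
        by (simp only: fourier_coeff_diff[OF p_simps(3) fL cL] fourier_coeff_scale)
      also have "\<dots> = 0"
        using that Hp_coeff[OF Suc.prems, of "n + 1"]
        by (cases "n = -1") (auto simp: fourier_coeff_powi f0_def simp del: power_int_0_right)
      finally show ?thesis .
    qed
    ultimately show ?thesis by (simp add: Hp_def)
  qed
  obtain g where g: "g \<in> Hp p" "\<And>t. t \<in> sphere 0 1 \<Longrightarrow> S g t = S (\<lambda>t. t powi (- int n) * h t) t"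
    using Suc.IH[OF h] by blast
  obtain e where e: "e \<in> Hp p" "\<And>t. t \<in> sphere 0 1 \<Longrightarrow> S e t = S (\<lambda>t. t powi (- int (Suc n))) t"
    using S_powi_Hp by blast
  have "S (\<lambda>t. g t + f0 * e t) t = S (\<lambda>t. t powi (- int (Suc n)) * f t) t" if t: "t \<in> sphere 0 1" for t
  proof -
    have "S (\<lambda>t. g t + f0 * e t) t = S (\<lambda>t. t powi (- int n) * h t + f0 * t powi (- int (Suc n))) t"
      by (simp only: S_add S_scale g(2)[OF t] e(2)[OF t])
    also have "\<dots> = S (\<lambda>t. t powi (- int (Suc n)) * f t) t"
    proof (rule S_cong[OF _ t])
      fix t :: complex assume "t \<in> sphere 0 1"
      then have "t \<noteq> 0" by auto
      moreover have "- int (Suc n) = - int n + (-1)" by simp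
      ultimately have "t powi (- int n) * t powi (-1) = t powi (- int (Suc n))"
        by (simp only: power_int_add simp_thms)
      then have "t powi (- int n) * h t = t powi (- int (Suc n)) * (f t - f0)"
        by (simp add: h_def flip: mult.assoc)
      then show "t powi (- int n) * h t + f0 * t powi (- int (Suc n)) = t powi (- int (Suc n)) * f t"
        by (simp add: algebra_simps)
    qed
    finally show ?thesis .
  qed
  then show ?case using Hp_add[OF p_simps(3) g(1) Hp_scale[OF e(1)]] by blast
qed

text \<open>The factor is invariant under conjugation of \<open>t\<close> and therefore commutes
  with \<open>S\<close>. The summand \<open>t^N f\<close> is in \<open>H^p\<close> already;
  \<open>t^-N f\<close> is replaced by means of \<open>S_shift_Hp\<close>.\<close>

lemma S_mult_even:
  assumes f: "f \<in> Hp p"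
  shows "\<exists>g\<in>Hp p. \<forall>t\<in>sphere 0 1. S g t = (t powi int N + t powi (- int N)) * S f t"
proof -
  have up: "(\<lambda>t. t powi int N * f t) \<in> Hp p"
    using f fourier_coeff_powi_mult[of "int N" f] by (auto simp: Hp_def intro!: Lp_powi_mult p_simps simp del: power_int_of_nat)
  obtain g where g: "g \<in> Hp p" "\<And>t. t \<in> sphere 0 1 \<Longrightarrow> S g t = S (\<lambda>t. t powi (- int N) * f t) t"
    using S_shift_Hp[OF f] by blast
  have "S (\<lambda>t. t powi int N * f t + g t) t = (t powi int N + t powi (- int N)) * S f t"
    if t: "t \<in> sphere 0 1" for t
  proof -
    have "cnj t = inverse t" using t by (rule cnj_on_circle)
    then have c: "cnj t powi k = t powi (- k)" for k by (simp add: power_int_inverse power_int_minus)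
    show ?thesis
      by (simp only: S_add g(2)[OF t]) (simp only: S_def c minus_minus, simp add: algebra_simps)
  qed
  then show ?thesis using Hp_add[OF p_simps(3) up g(1)] by blast
qed

section \<open>A nontrivial kernel puts all polynomials into the range\<close>

lemma kernel_imp_powers_in_range:
  assumes f: "f \<in> Hp p" "\<not> (AE t in circle. f t = 0)" and ker: "\<And>n. n \<ge> 0 \<Longrightarrow> fourier_coeff (aS f) n = 0"
  shows "\<exists>g\<in>Hp p. \<forall>j\<ge>0. fourier_coeff (aS g) j = (if j = int n then 1 else 0)"
proof -
  define c where "c = fourier_coeff (aS f)"
  have fL: "aS f \<in> Lp p" by (rule aS_Lp[OF Hp_Lp[OF f(1)]])
  \<comment> \<open>Otherwise \<open>a S f\<close> vanishes almost everywhere; invertibility of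
    \<open>a\<close> removes the factor and injectivity of \<open>S\<close> forces
    \<open>f = 0\<close>.\<close>
  have "\<exists>n. c n \<noteq> 0"
  proof (rule ccontr)
    assume "\<nexists>n. c n \<noteq> 0"
    then have "AE t in circle. aS f t = 0"
      by (intro fourier_coeff_zero_imp_AE_zero[OF p fL]) (simp add: c_def)
    moreover obtain b where "AE t in circle. a t * b t = 1" using a by (auto simp: GLinf_def)
    ultimately have "AE t in circle. S f t = 0"
      by eventually_elim (auto simp: aS_def)
    then show False using S_injective f by blast
  qed
  then obtain l where l: "c l \<noteq> 0" by blast
  then have "l < 0" using ker[of l] unfolding c_def by (metis not_less)
  then have ex: "c (- int (nat (- l))) \<noteq> 0" using l by simp
  \<comment> \<open>\<open>- k\<close> is the highest frequency of \<open>a S f\<close>: the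
    nonnegative ones are excluded by \<open>ker\<close>, and those between by minimality.\<close>
  define k where "k = (LEAST k. c (- int k) \<noteq> 0)"
  have k: "c (- int k) \<noteq> 0" "\<And>i. i < k \<Longrightarrow> c (- int i) = 0"
    unfolding k_def using LeastI[of "\<lambda>k. c (- int k) \<noteq> 0", OF ex] not_less_Least by blast+
  have c0: "c j = 0" if "- int k < j" for j
  proof (cases "j \<ge> 0")
    case False
    then show ?thesis using k(2)[of "nat (- j)"] that by simp
  qed (use ker in \<open>simp add: c_def\<close>)
  have shift: "\<exists>g\<in>Hp p. \<forall>j\<ge>0. fourier_coeff (aS g) j = c (j - int N)" for N
  proof -
    obtain g where g: "g \<in> Hp p" "\<And>t. t \<in> sphere 0 1 \<Longrightarrow> S g t = (t powi int N + t powi (- int N)) * S f t"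
      using S_mult_even[OF f(1)] by blast
    have "fourier_coeff (aS g) j = c (j - int N)" if "j \<ge> 0" for j
    proof -
      have "fourier_coeff (aS g) j = fourier_coeff (\<lambda>t. t powi int N * aS f t + t powi (- int N) * aS f t) j"
        by (rule fourier_coeff_cong) (simp add: aS_def g(2) algebra_simps)
      also have "\<dots> = c (j - int N) + c (j + int N)"
        using fourier_coeff_add[OF p_simps(3) Lp_powi_mult Lp_powi_mult, of "aS f" "aS f" "int N" "- int N" j] fL p_simps
        by (simp add: fourier_coeff_powi_mult c_def del: power_int_of_nat)
      \<comment> \<open>The factor \<open>t^-N\<close> moves frequencies further down, so only
        \<open>t^N\<close> contributes at \<open>j \<ge> 0\<close>.\<close>
      also have "c (j + int N) = 0" using ker that by (simp add: c_def)
      finally show ?thesis by simp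
    qed
    then show ?thesis using g(1) by blast
  qed
  show ?thesis
  proof (induction n rule: less_induct)
    case (less n)
    then obtain \<phi> where \<phi>: "\<And>i. i < n \<Longrightarrow> \<phi> i \<in> Hp p"
      "\<And>i j. i < n \<Longrightarrow> j \<ge> 0 \<Longrightarrow> fourier_coeff (aS (\<phi> i)) j = (if j = int i then 1 else 0)"
      by metis
    \<comment> \<open>Raising by \<open>n + k\<close> places the top coefficient
      \<open>c (- k)\<close> exactly at frequency \<open>n\<close>. The lower coefficients are then
      removed with the preimages of smaller powers from the induction hypothesis, and dividing by
      \<open>\<alpha>\<close> normalizes the result.\<close>
    obtain g where g: "g \<in> Hp p" "\<And>j. j \<ge> 0 \<Longrightarrow> fourier_coeff (aS g) j = c (j - int (n + k))"
      using shift by blast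
    define \<alpha> where "\<alpha> = c (- int k)"
    define u where "u t = (\<Sum>i<n. c (int i - int (n + k)) * \<phi> i t)" for t
    have u: "u \<in> Hp p" unfolding u_def[abs_def] using \<phi>(1) by (intro Hp_sum p_simps Hp_scale) auto
    have cu: "fourier_coeff (aS u) j = (if j < int n then c (j - int (n + k)) else 0)" if j: "j \<ge> 0" for j
    proof -
      have "fourier_coeff (aS u) j = (\<Sum>i<n. c (int i - int (n + k)) * fourier_coeff (aS (\<phi> i)) j)"
        unfolding u_def[abs_def] using \<phi>(1)
        by (subst coeff_aS_sum) (auto simp: coeff_aS_scale intro!: Hp_Lp Hp_scale)
      also have "\<dots> = (\<Sum>i<n. if i = nat j then c (int i - int (n + k)) else 0)"
        using j by (intro sum.cong) (auto simp: \<phi>(2))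
      also have "\<dots> = (if j < int n then c (j - int (n + k)) else 0)"
        using j by auto
      finally show ?thesis .
    qed
    have "(\<lambda>t. (1 / \<alpha>) * (g t - u t)) \<in> Hp p" by (intro Hp_scale Hp_diff p_simps g u)
    moreover have "fourier_coeff (aS (\<lambda>t. (1 / \<alpha>) * (g t - u t))) j = (if j = int n then 1 else 0)"
      if j: "j \<ge> 0" for j
    proof -
      have "fourier_coeff (aS (\<lambda>t. (1 / \<alpha>) * (g t - u t))) j = (1 / \<alpha>) * (fourier_coeff (aS g) j - fourier_coeff (aS u) j)"
        by (simp only: coeff_aS_scale coeff_aS_diff[OF Hp_Lp[OF g(1)] Hp_Lp[OF u]])
      also have "\<dots> = (1 / \<alpha>) * (if j < int n then 0 else c (j - int (n + k)))"
        using g(2)[OF j] cu[OF j] by simp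
      also have "\<dots> = (if j = int n then 1 else 0)"
        using k(1) c0[of "j - int (n + k)"] by (auto simp: \<alpha>_def)
      finally show ?thesis .
    qed
    ultimately show ?case by blast
  qed
qed

lemma kernel_imp_poly_in_range:
  assumes f: "f \<in> Hp p" "\<not> (AE t in circle. f t = 0)" and ker: "AE t in circle. A f t = 0"
  shows "\<exists>g\<in>Hp p. AE t in circle. A g t = poly q t"
proof -
  have "fourier_coeff (aS f) n = 0" if "n \<ge> 0" for n
    using fourier_coeff_cong_AE[OF Lp_measurable[OF Hp_Lp[OF A_Hp[OF f(1)]]] _ ker, of n] that
    by (simp add: A_coeff'[OF f(1)] fourier_coeff_zero)
  from kernel_imp_powers_in_range[OF f this]
  obtain \<phi> where \<phi>: "\<And>n. \<phi> n \<in> Hp p"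
    "\<And>n j. j \<ge> 0 \<Longrightarrow> fourier_coeff (aS (\<phi> n)) j = (if j = int n then 1 else 0)"
    by metis
  define g where "g t = (\<Sum>i\<le>degree q. coeff q i * \<phi> i t)" for t
  have g: "g \<in> Hp p" unfolding g_def[abs_def]
    by (rule Hp_sum[OF p_simps(3)]) (intro Hp_scale \<phi>(1))
  have "AE t in circle. A g t = poly q t"
  proof (rule Hp_eqI[OF p A_Hp[OF g] Hp_poly[OF p_simps(1)]])
    fix n :: int assume n: "n \<ge> 0"
    have "fourier_coeff (A g) n = (\<Sum>i\<le>degree q. coeff q i * fourier_coeff (aS (\<phi> i)) n)"
      unfolding A_coeff'[OF g n] unfolding g_def[abs_def]
      by (subst coeff_aS_sum) (auto simp: coeff_aS_scale intro!: Hp_Lp Hp_scale \<phi>(1))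
    also have "\<dots> = (\<Sum>i\<le>degree q. if i = nat n then coeff q i else 0)"
      using n by (intro sum.cong) (auto simp: \<phi>(2))
    also have "\<dots> = fourier_coeff (poly q) n"
      using n by (auto simp: fourier_coeff_poly coeff_eq_0)
    finally show "fourier_coeff (A g) n = fourier_coeff (poly q) n" .
  qed
  then show ?thesis using g by blast
qed

theorem generalized_imp_one_sided_invertible:
  assumes "generalized_invertible_Hp p A"
  shows "one_sided_invertible_Hp p A"
proof -
  obtain B where B: "bounded_op_Hp p B" and ABA: "\<And>f. f \<in> Hp p \<Longrightarrow> AE t in circle. A (B (A f)) t = A f t"
    using assms unfolding generalized_invertible_Hp_def op_eq_Hp_def by auto
  have B_Hp: "f \<in> Hp p \<Longrightarrow> B f \<in> Hp p" for f by (rule bounded_op_HpD(1)[OF B p_simps(3)])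
  show ?thesis
  proof (cases "\<forall>f\<in>Hp p. (AE t in circle. A f t = 0) \<longrightarrow> (AE t in circle. f t = 0)")
    case True
    have "AE t in circle. B (A f) t = f t" if f: "f \<in> Hp p" for f
    proof -
      note BAf = B_Hp[OF A_Hp[OF f]]
      let ?d = "\<lambda>t. B (A f) t - f t"
      have d: "?d \<in> Hp p" by (rule Hp_diff[OF p_simps(3) BAf f])
      \<comment> \<open>Linearity of \<open>A\<close> is recovered coefficientwise from
        \<open>aS\<close>; \<open>A B A = A\<close> then places \<open>B A f - f\<close> in the
        trivial kernel.\<close>
      have "AE t in circle. A ?d t = 0"
      proof (rule Hp_eqI[OF p A_Hp[OF d] Hp_zero])
        fix n :: int assume n: "n \<ge> 0"
        have "fourier_coeff (A ?d) n = fourier_coeff (A (B (A f))) n - fourier_coeff (A f) n"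
          using n by (simp add: A_coeff' d BAf f coeff_aS_diff Hp_Lp)
        also have "fourier_coeff (A (B (A f))) n = fourier_coeff (A f) n"
          by (intro fourier_coeff_cong_AE ABA f Lp_measurable[where p = p] Hp_Lp A_Hp BAf)
        finally show "fourier_coeff (A ?d) n = fourier_coeff (\<lambda>t. 0) n"
          by (simp add: fourier_coeff_zero)
      qed
      then have "AE t in circle. ?d t = 0" using True d by blast
      then show ?thesis by eventually_elim simp
    qed
    then have "left_invertible_Hp p A"
      unfolding left_invertible_Hp_def op_eq_Hp_def using B by auto
    then show ?thesis by (simp add: one_sided_invertible_Hp_def)
  next
    case False
    then obtain f where f: "f \<in> Hp p" "\<not> (AE t in circle. f t = 0)" "AE t in circle. A f t = 0"
      by blast
    have poly: "fourier_coeff (aS (B (poly q))) n = fourier_coeff (poly q) n" if n: "n \<ge> 0" for q n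
    proof -
      obtain g where g: "g \<in> Hp p" "AE t in circle. A g t = poly q t"
        using kernel_imp_poly_in_range[OF f] by blast
      have q: "poly q \<in> Hp p" by (rule Hp_poly[OF p_simps(1)])
      note Bg = B_Hp[OF A_Hp[OF g(1)]]
      \<comment> \<open>With the polynomial realized as \<open>A g\<close>, the identity
        \<open>A B A = A\<close> becomes \<open>A B q = q\<close> on coefficients.\<close>
      have "AE t in circle. B (A g) t = B (poly q) t"
        by (rule bounded_op_Hp_cong_AE[OF B p_simps(3) A_Hp[OF g(1)] q g(2)])
      then have "fourier_coeff (aS (B (poly q))) n = fourier_coeff (aS (B (A g))) n"
        by (intro coeff_aS_cong_AE[symmetric] Hp_Lp Bg B_Hp q)
      also have "\<dots> = fourier_coeff (A (B (A g))) n" by (rule A_coeff'[OF Bg n, symmetric])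
      also have "\<dots> = fourier_coeff (A g) n"
        by (intro fourier_coeff_cong_AE ABA g Lp_measurable[where p = p] Hp_Lp A_Hp Bg)
      also have "\<dots> = fourier_coeff (poly q) n"
        by (intro fourier_coeff_cong_AE g Lp_measurable[where p = p] Hp_Lp A_Hp q)
      finally show ?thesis .
    qed
    \<comment> \<open>Each coefficient of \<open>A B y\<close> is a limit of coefficients for
      polynomials tending to \<open>y\<close>, because \<open>B\<close> is bounded and the
      coefficients of \<open>aS\<close> are continuous.\<close>
    have "AE t in circle. A (B y) t = y t" if y: "y \<in> Hp p" for y
    proof (rule Hp_eqI[OF p A_Hp[OF B_Hp[OF y]] y])
      fix n :: int assume n: "n \<ge> 0"
      obtain q where q: "(\<lambda>k. Lp_pow p (\<lambda>t. poly (q k) t - y t)) \<longlonglongrightarrow> 0"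
        using Hp_poly_dense[OF p y] by metis
      have qH: "poly (q k) \<in> Hp p" for k by (rule Hp_poly[OF p_simps(1)])
      obtain C where C: "\<And>f. f \<in> Hp p \<Longrightarrow> Lp_pow p (B f) \<le> C * Lp_pow p f"
        using bounded_op_HpD(3)[OF B p_simps(3)] by blast
      have le: "Lp_pow p (\<lambda>t. B (poly (q k)) t - B y t) \<le> C * Lp_pow p (\<lambda>t. poly (q k) t - y t)" for k
      proof -
        have d: "(\<lambda>t. poly (q k) t - y t) \<in> Hp p" by (rule Hp_diff[OF p_simps(3) qH y])
        have "Lp_pow p (B (\<lambda>t. poly (q k) t - y t)) = Lp_pow p (\<lambda>t. B (poly (q k)) t - B y t)"
          by (intro Lp_cong_AE(2) Hp_Lp B_Hp d bounded_op_HpD(2)[OF B p_simps(3)] qH y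
              Lp_measurable[where p = p] Lp_diff p_simps)
        then show ?thesis using C[OF d] by simp
      qed
      have "(\<lambda>k. Lp_pow p (\<lambda>t. B (poly (q k)) t - B y t)) \<longlonglongrightarrow> 0"
        by (rule tendsto_sandwich[OF _ _ tendsto_const tendsto_mult_right_zero[OF q, of C]])
           (auto simp: Lp_pow_nonneg le)
      then have "(\<lambda>k. fourier_coeff (aS (B (poly (q k)))) n) \<longlonglongrightarrow> fourier_coeff (aS (B y)) n"
        by (intro coeff_aS_tendsto Hp_Lp B_Hp qH y)
      moreover have "(\<lambda>k. fourier_coeff (poly (q k)) n) \<longlonglongrightarrow> fourier_coeff y n"
        by (intro fourier_coeff_tendsto[OF p_simps(3)] Hp_Lp qH y q)
      ultimately have "fourier_coeff (aS (B y)) n = fourier_coeff y n"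
        unfolding poly[OF n] by (rule LIMSEQ_unique)
      then show "fourier_coeff (A (B y)) n = fourier_coeff y n"
        by (simp add: A_coeff'[OF B_Hp[OF y] n])
    qed
    then have "right_invertible_Hp p A"
      unfolding right_invertible_Hp_def op_eq_Hp_def using B by auto
    then show ?thesis by (simp add: one_sided_invertible_Hp_def)
  qed
qed

end

text \<open>The factor \<open>k\<close> is the quotient of the Hankel and Toeplitz symbols. Together
  with the \<open>cnj t\<close> hidden in \<open>flip_J\<close> it produces
  \<open>t powi m\<close>.\<close>

lemma toeplitz_hankelI:
  assumes p: "1 < p" and a: "a \<in> GLinf"
    and sign: "m = -1 \<and> (\<sigma> = 1 \<or> \<sigma> = -1) \<or> m = 0 \<and> \<sigma> = 1 \<or> m = -2 \<and> \<sigma> = -1"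
    and b: "b = (\<lambda>t. a t * k t)" "k \<in> Linf" "\<And>t. t \<in> sphere 0 1 \<Longrightarrow> k t * cnj t = t powi m"
  shows "toeplitz_hankel p a \<sigma> m (\<lambda>f t. toeplitz p a f t + \<sigma> * hankel p b f t)"
proof
  have p0: "0 \<le> p" "1 \<le> p" using p by auto
  have aL: "a \<in> Linf" using a by (simp add: GLinf_def)
  have bL: "b \<in> Linf" unfolding b(1) by (rule Linf_mult[OF aL b(2)])
  fix f assume f: "f \<in> Hp p"
  note fL = Hp_Lp[OF f]
  have T: "(\<lambda>t. a t * f t) \<in> Lp p" by (rule Lp_mult_Linf[OF p0(1) aL fL])
  have H: "(\<lambda>t. b t * riesz_Q p (flip_J f) t) \<in> Lp p"
    by (rule Lp_mult_Linf[OF p0(1) bL riesz_Q_flip_J(1)[OF p f]])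
  have TH: "toeplitz p a f \<in> Hp p" "hankel p b f \<in> Hp p"
    unfolding toeplitz_def hankel_def by (intro riesz_P_Hp[OF p] T H)+
  then show "(\<lambda>t. toeplitz p a f t + \<sigma> * hankel p b f t) \<in> Hp p"
    by (intro Hp_add Hp_scale p0)
  have H': "(\<lambda>t. b t * flip_J f t) \<in> Lp p"
    by (intro Lp_mult_Linf Lp_flip_J p0 bL fL)
  fix n :: int assume n: "n \<ge> 0"
  have "fourier_coeff (\<lambda>t. toeplitz p a f t + \<sigma> * hankel p b f t) n =
      fourier_coeff (toeplitz p a f) n + \<sigma> * fourier_coeff (hankel p b f) n"
    using fourier_coeff_add[OF p0(2) Hp_Lp[OF TH(1)] Lp_scale(1)[OF Hp_Lp[OF TH(2)]]]
    by (simp add: fourier_coeff_scale)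
  also have "fourier_coeff (toeplitz p a f) n = fourier_coeff (\<lambda>t. a t * f t) n"
    using n by (simp add: toeplitz_def riesz_P[OF p T])
  also have "fourier_coeff (hankel p b f) n = fourier_coeff (\<lambda>t. b t * riesz_Q p (flip_J f) t) n"
    using n by (simp add: hankel_def riesz_P[OF p H])
  also have "\<dots> = fourier_coeff (\<lambda>t. b t * flip_J f t) n"
    using riesz_Q_flip_J(2)[OF p f]
    by (intro fourier_coeff_cong_AE Lp_measurable[OF H] Lp_measurable[OF H']) (auto elim: eventually_mono)
  also have "fourier_coeff (\<lambda>t. a t * f t) n + \<sigma> * fourier_coeff (\<lambda>t. b t * flip_J f t) n =
      fourier_coeff (\<lambda>t. a t * f t + \<sigma> * (b t * flip_J f t)) n"
    using fourier_coeff_add[OF p0(2) T Lp_scale(1)[OF H']] by (simp add: fourier_coeff_scale)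
  also have "\<dots> = fourier_coeff (\<lambda>t. a t * (f t + \<sigma> * (t powi m * f (cnj t)))) n"
    by (rule fourier_coeff_cong) (simp add: b(1) flip_J_def algebra_simps flip: b(3))
  finally show "fourier_coeff (\<lambda>t. toeplitz p a f t + \<sigma> * hankel p b f t) n =
      fourier_coeff (\<lambda>t. a t * (f t + \<sigma> * (t powi m * f (cnj t)))) n" .
qed (use p a sign in auto)

theorem corollary4p2:
  fixes p :: real
    and a\<^sub>1 a\<^sub>2 a\<^sub>3 a\<^sub>4 :: "complex \<Rightarrow> complex"
    and A :: "(complex \<Rightarrow> complex) \<Rightarrow> complex \<Rightarrow> complex"
  assumes "1 < p"
    and "a\<^sub>1 \<in> GLinf" and "a\<^sub>2 \<in> GLinf" and "a\<^sub>3 \<in> GLinf" and "a\<^sub>4 \<in> GLinf"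
    and "A \<in> {\<lambda>f t. toeplitz p a\<^sub>1 f t - hankel p (\<lambda>s. a\<^sub>1 s * inverse s) f t,
              \<lambda>f t. toeplitz p a\<^sub>2 f t + hankel p (\<lambda>s. a\<^sub>2 s * s) f t,
              \<lambda>f t. toeplitz p a\<^sub>3 f t + hankel p a\<^sub>3 f t,
              \<lambda>f t. toeplitz p a\<^sub>4 f t - hankel p a\<^sub>4 f t}"
    and "generalized_invertible_Hp p A"
  shows "one_sided_invertible_Hp p A"
proof -
  have inv: "inverse \<in> Linf" by (intro Linf_continuous continuous_intros) auto
  have one: "(\<lambda>t. 1) \<in> Linf" by (intro Linf_continuous continuous_intros)
  note I = toeplitz_hankelI[OF assms(1)]
  \<comment> \<open>The four exponents: \<open>k = t^-1\<close> gives
    \<open>t^-1 * t^-1 = t^-2\<close>, \<open>k = t\<close> gives \<open>t * t^-1 = t^0\<close>, and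
    \<open>k = 1\<close> gives \<open>t^-1\<close> in the last two cases.\<close>
  have "toeplitz_hankel p a\<^sub>1 (-1) (-2) (\<lambda>f t. toeplitz p a\<^sub>1 f t + (-1) * hankel p (\<lambda>s. a\<^sub>1 s * inverse s) f t)"
    using inv by (intro I assms) (auto simp: cnj_on_circle power_int_minus power2_eq_square)
  moreover have "toeplitz_hankel p a\<^sub>2 1 0 (\<lambda>f t. toeplitz p a\<^sub>2 f t + 1 * hankel p (\<lambda>s. a\<^sub>2 s * s) f t)"
    using Linf_id by (intro I assms) (auto simp: complex_norm_square[symmetric])
  moreover have "toeplitz_hankel p a\<^sub>3 1 (-1) (\<lambda>f t. toeplitz p a\<^sub>3 f t + 1 * hankel p a\<^sub>3 f t)"
    by (rule I[where k = "\<lambda>t. 1"]) (auto simp: assms one cnj_on_circle power_int_minus)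
  moreover have "toeplitz_hankel p a\<^sub>4 (-1) (-1) (\<lambda>f t. toeplitz p a\<^sub>4 f t + (-1) * hankel p a\<^sub>4 f t)"
    by (rule I[where k = "\<lambda>t. 1"]) (auto simp: assms one cnj_on_circle power_int_minus)
  ultimately obtain a \<sigma> m where "toeplitz_hankel p a \<sigma> m A"
    using assms(6) by auto
  then show ?thesis
    using assms(7) by (rule toeplitz_hankel.generalized_imp_one_sided_invertible)
qed

end
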